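(* Let $\sigma$ be a connection on $B(\mathcal{H})^+$ with representing function $f:[0,\infty)\to[0,\infty)$ and associated measure $\mu$ on $[0,1]$. Then the following statements are equivalent: (1) $\sigma$ is cancellable; (2) $\sigma$ is neither a scalar multiple of the left-trivial mean nor a scalar multiple of the right-trivial mean; (3) $f$ and its transpose are injective; (4) $f$ is neither a constant function nor a scalar multiple of the identity function $x\mapsto x$; (5) $\mu$ is neither a scalar multiple of $\delta_0$ nor a scalar multiple of $\delta_1$. In particular, every nontrivial mean is cancellable.
   Context: $\mathcal{H}$ is a Hilbert space, $B(\mathcal{H})$ the bounded linear operators on it, $B(\mathcal{H})^+$ the positive (semidefinite) operators; $A\le B$ means $B-A\in B(\mathcal{H})^+$; $A>0$ means $A$ is strictly positive (positive and invertible). A connection is a binary operation $\sigma$ on $B(\mathcal{H})^+$ such that for all positive $A,B,C,D$: (M1) $A\le C$, $B\le D$ imply $A\,\sigma\,B\le C\,\sigma\,D$; (M2) $C(A\,\sigma\,B)C\le (CAC)\,\sigma\,(CBC)$; (M3) if $A_n\downarrow A$ and $B_n\downarrow B$ then $A_n\,\sigma\,B_n\downarrow A\,\sigma\,B$, where $A_n\downarrow A$ means $(A_n)$ is a decreasing sequence converging strongly to $A$. A mean is a connection with $I\,\sigma\,I=I$. The left-trivial mean is $(A,B)\mapsto A$, the right-trivial mean is $(A,B)\mapsto B$; a mean is nontrivial if it is neither of these. A connection $\sigma$ is left cancellable if for all $A>0$, $B\ge0$, $C\ge0$, $A\,\sigma\,B=A\,\sigma\,C$ implies $B=C$; right cancellable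 if for all $A>0$, $B\ge0$, $C\ge0$, $B\,\sigma\,A=C\,\sigma\,A$ implies $B=C$; cancellable if it is both. A function $f:[0,\infty)\to[0,\infty)$ is operator monotone if (with the continuous functional calculus, $f$ continuous) $A\le B$ implies $f(A)\le f(B)$ for all positive operators $A,B$ on every Hilbert space. Representing function (Kubo–Ando theorem, taken as known): for a connection $\sigma$ there is a unique operator monotone $f:[0,\infty)\to[0,\infty)$ with $f(x)I=I\,\sigma\,(xI)$ for all $x\ge 0$; $\sigma\mapsto f$ is a bijection, and $f(A)=I\,\sigma\,A$ for all $A\ge0$. Associated measure (taken as known): for a connection $\sigma$ there is a unique finite positive Borel measure $\mu$ on $[0,1]$ with $A\,\sigma\,B=\int_{[0,1]}A\,!_t\,B\,d\mu(t)$ for all $A,B\ge 0$; then $f(x)=\int_{[0,1]}(1\,!_t\,x)\,d\mu(t)$ for $x\ge0$. Here $A\,!_t\,B=[(1-t)A^{-1}+tB^{-1}]^{-1}$ for $A,B>0$, extended to $A,B\ge 0$ as the strong limit of $(A+\epsilon I)\,!_t\,(B+\epsilon I)$ as $\epsilon\downarrow 0$ (so $A\,!_0\,B=A$, $A\,!_1\,B=B$). $\delta_0,\delta_1$ are the Dirac measures at $0$ and $1$. The transpose of $f$ is $x\mapsto xf(1/x)$, $x>0$; it is (extended to $x=0$ by continuity) the representing function of the transpose connection $(A,B)\mapsto B\,\sigma\,A$. Scalars in "scalar multiple" are nonnegative reals. *)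

theory Defs
  imports
    "HOL-Probability.Giry_Monad"
    "HOL-Computational_Algebra.Polynomial"
begin

section \<open>Complex Hilbert spaces\<close>

text \<open>
  A complex Hilbert space is also a real one, with inner product the real part of the
  complex one; building on \<^class>\<open>real_inner\<close> makes the norm and topology of the library
  the Hilbert space ones. The inner product is conjugate-linear in the first argument.
\<close>

class complex_hilbert_space = real_inner + banach +
  fixes scaleC :: "complex \<Rightarrow> 'a \<Rightarrow> 'a" (infixr "*\<^sub>C" 75)
    and cinner :: "'a \<Rightarrow> 'a \<Rightarrow> complex"
  assumes scaleC_add_right: "c *\<^sub>C (x + y) = c *\<^sub>C x + c *\<^sub>C y"
    and scaleC_add_left: "(c + d) *\<^sub>C x = c *\<^sub>C x + d *\<^sub>C x"
    and scaleC_scaleC: "c *\<^sub>C (d *\<^sub>C x) = (c * d) *\<^sub>C x"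
    and scaleC_of_real: "complex_of_real r *\<^sub>C x = r *\<^sub>R x"
    and cinner_commute: "cinner x y = cnj (cinner y x)"
    and cinner_add_right: "cinner x (y + z) = cinner x y + cinner x z"
    and cinner_scaleC_right: "cinner x (c *\<^sub>C y) = c * cinner x y"
    and Re_cinner: "Re (cinner x y) = inner x y"

instantiation complex :: complex_hilbert_space
begin

definition scaleC_complex :: "complex \<Rightarrow> complex \<Rightarrow> complex"
  where "scaleC_complex c z = c * z"

definition cinner_complex :: "complex \<Rightarrow> complex \<Rightarrow> complex"
  where "cinner_complex w z = cnj w * z"

instance
  by standard
    (simp_all add: scaleC_complex_def cinner_complex_def inner_complex_def
      scaleR_conv_of_real algebra_simps)

end


section \<open>Positive operators\<close>

text \<open>
  The type \<^typ>\<open>'a \<Rightarrow>\<^sub>L 'a\<close> consists of the bounded real-linear operators; the elements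
  of B(H) are those among them that are complex-linear.
\<close>

definition complex_linear_op :: "('a::complex_hilbert_space \<Rightarrow>\<^sub>L 'a) \<Rightarrow> bool"
  where "complex_linear_op A \<longleftrightarrow>
    (\<forall>c x. blinfun_apply A (c *\<^sub>C x) = c *\<^sub>C blinfun_apply A x)"

definition positive_op :: "('a::complex_hilbert_space \<Rightarrow>\<^sub>L 'a) \<Rightarrow> bool"
  where "positive_op A \<longleftrightarrow> complex_linear_op A \<and>
    (\<forall>x. \<exists>r\<ge>0. cinner x (blinfun_apply A x) = complex_of_real r)"

definition op_le :: "('a::complex_hilbert_space \<Rightarrow>\<^sub>L 'a) \<Rightarrow> ('a \<Rightarrow>\<^sub>L 'a) \<Rightarrow> bool"
    (infix "\<le>\<^sub>o" 50)
  where "A \<le>\<^sub>o B \<longleftrightarrow> positive_op (B - A)"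

definition is_op_inverse :: "('a::complex_hilbert_space \<Rightarrow>\<^sub>L 'a) \<Rightarrow> ('a \<Rightarrow>\<^sub>L 'a) \<Rightarrow> bool"
  where "is_op_inverse A B \<longleftrightarrow> A o\<^sub>L B = id_blinfun \<and> B o\<^sub>L A = id_blinfun"

definition op_invertible :: "('a::complex_hilbert_space \<Rightarrow>\<^sub>L 'a) \<Rightarrow> bool"
  where "op_invertible A \<longleftrightarrow> (\<exists>B. is_op_inverse A B)"

definition op_inverse :: "('a::complex_hilbert_space \<Rightarrow>\<^sub>L 'a) \<Rightarrow> ('a \<Rightarrow>\<^sub>L 'a)"
  where "op_inverse A = (THE B. is_op_inverse A B)"

definition strictly_positive_op :: "('a::complex_hilbert_space \<Rightarrow>\<^sub>L 'a) \<Rightarrow> bool"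
  where "strictly_positive_op A \<longleftrightarrow> positive_op A \<and> op_invertible A"

definition decreases_to ::
    "(nat \<Rightarrow> ('a::complex_hilbert_space \<Rightarrow>\<^sub>L 'a)) \<Rightarrow> ('a \<Rightarrow>\<^sub>L 'a) \<Rightarrow> bool"
  where "decreases_to S A \<longleftrightarrow>
    (\<forall>n. S (Suc n) \<le>\<^sub>o S n) \<and>
    (\<forall>x. (\<lambda>n. blinfun_apply (S n) x) \<longlonglongrightarrow> blinfun_apply A x)"


section \<open>Connections and means\<close>

text \<open>
  A binary operation on the positive operators is a function on all operators whose
  values are only constrained, and only compared, at positive arguments.
\<close>

type_synonym 'a op_binary = "('a \<Rightarrow>\<^sub>L 'a) \<Rightarrow> ('a \<Rightarrow>\<^sub>L 'a) \<Rightarrow> ('a \<Rightarrow>\<^sub>L 'a)"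

definition connection :: "'a::complex_hilbert_space op_binary \<Rightarrow> bool"
  where "connection \<sigma> \<longleftrightarrow>
    (\<forall>A B. positive_op A \<and> positive_op B \<longrightarrow> positive_op (\<sigma> A B)) \<and>
    (\<forall>A B C D. positive_op A \<and> positive_op B \<and> positive_op C \<and> positive_op D \<and>
       A \<le>\<^sub>o C \<and> B \<le>\<^sub>o D \<longrightarrow> \<sigma> A B \<le>\<^sub>o \<sigma> C D) \<and>
    (\<forall>A B C. positive_op A \<and> positive_op B \<and> positive_op C \<longrightarrow>
       C o\<^sub>L \<sigma> A B o\<^sub>L C \<le>\<^sub>o \<sigma> (C o\<^sub>L A o\<^sub>L C) (C o\<^sub>L B o\<^sub>L C)) \<and>
    (\<forall>S T A B. (\<forall>n. positive_op (S n) \<and> positive_op (T n)) \<and>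
       positive_op A \<and> positive_op B \<and> decreases_to S A \<and> decreases_to T B \<longrightarrow>
       decreases_to (\<lambda>n. \<sigma> (S n) (T n)) (\<sigma> A B))"

definition mean :: "'a::complex_hilbert_space op_binary \<Rightarrow> bool"
  where "mean \<sigma> \<longleftrightarrow> connection \<sigma> \<and> \<sigma> id_blinfun id_blinfun = id_blinfun"

definition left_trivial_mean :: "'a::complex_hilbert_space op_binary"
  where "left_trivial_mean A B = A"

definition right_trivial_mean :: "'a::complex_hilbert_space op_binary"
  where "right_trivial_mean A B = B"

definition equal_on_positive ::
    "'a::complex_hilbert_space op_binary \<Rightarrow> 'a op_binary \<Rightarrow> bool"
  where "equal_on_positive \<sigma> \<tau> \<longleftrightarrow>
    (\<forall>A B. positive_op A \<and> positive_op B \<longrightarrow> \<sigma> A B = \<tau> A B)"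

definition scalar_multiple_of ::
    "'a::complex_hilbert_space op_binary \<Rightarrow> 'a op_binary \<Rightarrow> bool"
  where "scalar_multiple_of \<sigma> \<tau> \<longleftrightarrow>
    (\<exists>c\<ge>0. equal_on_positive \<sigma> (\<lambda>A B. c *\<^sub>R \<tau> A B))"

definition nontrivial_mean :: "'a::complex_hilbert_space op_binary \<Rightarrow> bool"
  where "nontrivial_mean \<sigma> \<longleftrightarrow> mean \<sigma> \<and>
    \<not> equal_on_positive \<sigma> left_trivial_mean \<and>
    \<not> equal_on_positive \<sigma> right_trivial_mean"

definition left_cancellable :: "'a::complex_hilbert_space op_binary \<Rightarrow> bool"
  where "left_cancellable \<sigma> \<longleftrightarrow>
    (\<forall>A B C. strictly_positive_op A \<and> positive_op B \<and> positive_op C \<and>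
       \<sigma> A B = \<sigma> A C \<longrightarrow> B = C)"

definition right_cancellable :: "'a::complex_hilbert_space op_binary \<Rightarrow> bool"
  where "right_cancellable \<sigma> \<longleftrightarrow>
    (\<forall>A B C. strictly_positive_op A \<and> positive_op B \<and> positive_op C \<and>
       \<sigma> B A = \<sigma> C A \<longrightarrow> B = C)"

definition cancellable :: "'a::complex_hilbert_space op_binary \<Rightarrow> bool"
  where "cancellable \<sigma> \<longleftrightarrow> left_cancellable \<sigma> \<and> right_cancellable \<sigma>"


section \<open>Representing functions\<close>

definition poly_op :: "real poly \<Rightarrow> ('a::complex_hilbert_space \<Rightarrow>\<^sub>L 'a) \<Rightarrow> ('a \<Rightarrow>\<^sub>L 'a)"
  where "poly_op p A = (\<Sum>i\<le>degree p. coeff p i *\<^sub>R (((o\<^sub>L) A ^^ i) id_blinfun))"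

text \<open>
  Only real points are considered: the spectrum of a positive operator is contained in
  the nonnegative reals.
\<close>

definition real_spectrum :: "('a::complex_hilbert_space \<Rightarrow>\<^sub>L 'a) \<Rightarrow> real set"
  where "real_spectrum A = {r. \<not> op_invertible (A - r *\<^sub>R id_blinfun)}"

text \<open>
  Continuous functional calculus: f(A) is the norm limit of p(A) as the polynomial p
  tends to f uniformly on the spectrum of A.
\<close>

definition cfc :: "(real \<Rightarrow> real) \<Rightarrow> ('a::complex_hilbert_space \<Rightarrow>\<^sub>L 'a) \<Rightarrow> ('a \<Rightarrow>\<^sub>L 'a)"
  where "cfc f A = (THE T. \<forall>p::nat \<Rightarrow> real poly.
    uniform_limit (real_spectrum A) (\<lambda>n. poly (p n)) f sequentially \<longrightarrow>
    (\<lambda>n. poly_op (p n) A) \<longlonglongrightarrow> T)"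

text \<open>
  The functions from the nonnegative reals to themselves are represented by functions on
  all reals, of which only the values at nonnegative arguments matter. The Hilbert space
  is a type, so monotonicity is demanded on the space given by the type argument.
\<close>

definition operator_monotone :: "'a::complex_hilbert_space itself \<Rightarrow> (real \<Rightarrow> real) \<Rightarrow> bool"
  where "operator_monotone _ f \<longleftrightarrow>
    (\<forall>x\<ge>0. f x \<ge> 0) \<and> continuous_on {0..} f \<and>
    (\<forall>A B :: 'a \<Rightarrow>\<^sub>L 'a. positive_op A \<and> positive_op B \<and> A \<le>\<^sub>o B \<longrightarrow> cfc f A \<le>\<^sub>o cfc f B)"

definition representing_function ::
    "'a::complex_hilbert_space op_binary \<Rightarrow> (real \<Rightarrow> real) \<Rightarrow> bool"
  where "representing_function \<sigma> f \<longleftrightarrow>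
    operator_monotone TYPE('a) f \<and>
    (\<forall>x\<ge>0. f x *\<^sub>R id_blinfun = \<sigma> id_blinfun (x *\<^sub>R id_blinfun))"

definition transpose_fun :: "(real \<Rightarrow> real) \<Rightarrow> real \<Rightarrow> real"
  where "transpose_fun f x =
    (if x = 0 then Lim (at_right 0) (\<lambda>y. y * f (1 / y)) else x * f (1 / x))"


section \<open>Associated measures\<close>

definition weighted_harmonic_mean :: "real \<Rightarrow> 'a::complex_hilbert_space op_binary"
  where "weighted_harmonic_mean t A B =
    (let h = (\<lambda>A B. op_inverse ((1 - t) *\<^sub>R op_inverse A + t *\<^sub>R op_inverse B)) in
     if strictly_positive_op A \<and> strictly_positive_op B then h A B
     else (THE T. \<forall>x. ((\<lambda>\<epsilon>. blinfun_apply
                (h (A + \<epsilon> *\<^sub>R id_blinfun) (B + \<epsilon> *\<^sub>R id_blinfun)) x)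
              \<longlongrightarrow> blinfun_apply T x) (at_right 0)))"

abbreviation borel_unit_interval :: "real measure"
  where "borel_unit_interval \<equiv> restrict_space borel {0..1}"

text \<open>
  The operator-valued integral is taken in the weak sense. The Bochner integral of the
  library needs a second countable space, which the operator space is not in infinite
  dimension.
\<close>

definition associated_measure ::
    "'a::complex_hilbert_space op_binary \<Rightarrow> real measure \<Rightarrow> bool"
  where "associated_measure \<sigma> \<mu> \<longleftrightarrow>
    finite_measure \<mu> \<and> sets \<mu> = sets borel_unit_interval \<and>
    (\<forall>A B. positive_op A \<and> positive_op B \<longrightarrow>
      (\<forall>x y. has_bochner_integral \<mu>
         (\<lambda>t. cinner x (blinfun_apply (weighted_harmonic_mean t A B) y))
         (cinner x (blinfun_apply (\<sigma> A B) y))))"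

definition scalar_multiple_of_dirac :: "real measure \<Rightarrow> real \<Rightarrow> bool"
  where "scalar_multiple_of_dirac \<mu> a \<longleftrightarrow>
    (\<exists>c\<ge>0. \<mu> = scale_measure (ennreal c) (return borel_unit_interval a))"

end

theory Submission
  imports Defs
begin

text \<open>
  The function \<open>rep_fun x = \<integral> harmonic_fun t x d\<mu>(t)\<close> with \<open>harmonic_fun t x = 1 !\<^sub>t x\<close> is constant
  when \<open>\<mu>\<close> is concentrated at 0 and strictly increasing otherwise, since \<open>harmonic_fun t\<close> is strictly
  increasing for \<open>t > 0\<close>. The operator \<open>I \<sigma> B\<close> is \<open>rep_fun B\<close> in the sense of the functional calculus,
  and an injective continuous function of \<open>B\<close> determines \<open>B\<close>. The transformer inequality is an
  equality for invertible \<open>C\<close>, so conjugating with the square root of \<open>A\<close> reduces left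
  cancellability to \<open>A = I\<close>. Reflecting \<open>\<mu>\<close> under \<open>t \<mapsto> 1 - t\<close> passes to the transpose connection
  and gives the statements about right cancellability.
\<close>

section \<open>Positive operators\<close>

text \<open>All conditions are compared through two numbers, the \<mu>-masses of
  \<open>{0..1} - {0}\<close> and \<open>{0..1} - {1}\<close>: the left-hand halves of the five
  statements say that the former is nonzero, the right-hand halves that the latter is. The main
  obstacle is to identify I \<sigma> B with \<open>rep_fun\<close> of B, because the operator
  integral is known only weakly, between two vectors. This shapes the functional calculus: it lives
  on \<open>{0..1}\<close>, every operator being rescaled by a bound M of its norm, and it
  approximates by Bernstein polynomials. The Bernstein polynomial of g depends linearly on finitely
  many values of g, so it commutes with integration in t, and dominated convergence does the rest.
  The same basis yields the positivity on which the calculus rests: up to a constant tending to 0, a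
  polynomial that is nonnegative on the unit interval has nonnegative Bernstein coefficients, and
  the products A^k (I - A)^(n-k) are positive by congruences alone.\<close>

lemma cinner_scaleC_left: "cinner (c *\<^sub>C x) y = cnj c * cinner x y"
  by (metis cinner_commute cinner_scaleC_right complex_cnj_mult)

lemma cinner_add_left: "cinner (x + y) z = cinner x z + cinner y z"
  by (metis cinner_commute cinner_add_right complex_cnj_add)

lemma scaleC_zero_right: "c *\<^sub>C (0::'a::complex_hilbert_space) = 0"
  using scaleC_add_right[of c 0 "0::'a"] by simp

lemma scaleC_diff_right: "c *\<^sub>C (x - y) = c *\<^sub>C x - c *\<^sub>C (y::'a::complex_hilbert_space)"
  by (metis add_diff_cancel_right' diff_add_cancel scaleC_add_right)

lemma scaleC_continuous: "X \<longlonglongrightarrow> x \<Longrightarrow> (\<lambda>n. c *\<^sub>C X n) \<longlonglongrightarrow> c *\<^sub>C x"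
proof -
  assume X: "X \<longlonglongrightarrow> x"
  \<comment> \<open>The class ties the norm to the real inner product only, so homogeneity for
    complex scalars has to come from \<open>cinner\<close>.\<close>
  have nrm: "norm (c *\<^sub>C y) = cmod c * norm y" for y :: 'a
  proof -
    have "cinner (c *\<^sub>C y) (c *\<^sub>C y) = of_real ((cmod c)\<^sup>2) * cinner y y"
      by (simp add: cinner_scaleC_left cinner_scaleC_right complex_norm_square mult_ac flip: of_real_power)
    then have "inner (c *\<^sub>C y) (c *\<^sub>C y) = (cmod c)\<^sup>2 * inner y y"
      by (simp flip: Re_cinner)
    then show ?thesis
      by (simp add: norm_eq_sqrt_inner real_sqrt_mult)
  qed
  have "(\<lambda>n. norm (X n - x)) \<longlonglongrightarrow> 0"
    using X by (simp add: LIM_zero_iff tendsto_norm_zero_iff)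
  then have "(\<lambda>n. cmod c * norm (X n - x)) \<longlonglongrightarrow> 0"
    by (simp add: tendsto_mult_right_zero)
  then have "(\<lambda>n. norm (c *\<^sub>C X n - c *\<^sub>C x)) \<longlonglongrightarrow> 0"
    by (simp add: nrm flip: scaleC_diff_right)
  then show ?thesis
    by (simp add: LIM_zero_iff tendsto_norm_zero_iff)
qed

text \<open>Lets the rest of the proof work with the real \<open>inner\<close>. Symmetry comes from
  polarization at x + iy, where the quadratic form is real; conversely, complex linearity and real
  symmetry make the imaginary part of \<open>cinner x (A x)\<close> equal to its own
  negative.\<close>

lemma positive_op_iff:
  "positive_op A \<longleftrightarrow> complex_linear_op A \<and> (\<forall>x y. inner x (A y) = inner (A x) y) \<and> (\<forall>x. 0 \<le> inner x (A x))"
proof (intro iffI conjI allI)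
  assume A: "positive_op A"
  then show lin: "complex_linear_op A"
    by (simp add: positive_op_def)
  show "0 \<le> inner x (A x)" for x
    using A unfolding positive_op_def by (metis Re_cinner Re_complex_of_real)
  show "inner x (A y) = inner (A x) y" for x y
  proof -
    define z where "z = \<i> *\<^sub>C y"
    have real: "Im (cinner v (A v)) = 0" for v
      using A unfolding positive_op_def by (metis Im_complex_of_real)
    have Az: "A z = \<i> *\<^sub>C A y"
      using lin by (simp add: complex_linear_op_def z_def)
    have "Im (cinner (x + z) (A (x + z))) = Im (cinner x (A z)) + Im (cinner z (A x))"
      using real[of x] real[of z]
      by (simp add: blinfun.add_right cinner_add_left cinner_add_right)
    then have "Im (cinner x (A z)) + Im (cinner z (A x)) = 0"
      using real by simp
    then have "Re (cinner x (A y)) = Re (cinner y (A x))"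
      unfolding Az by (simp add: z_def cinner_scaleC_left cinner_scaleC_right)
    then show ?thesis
      by (simp add: Re_cinner inner_commute)
  qed
next
  assume A: "complex_linear_op A \<and> (\<forall>x y. inner x (A y) = inner (A x) y) \<and> (\<forall>x. 0 \<le> inner x (A x))"
  have "cinner x (A x) = complex_of_real (inner x (A x))" for x
  proof (rule complex_eqI)
    have "Im (cinner x (A x)) = inner (\<i> *\<^sub>C x) (A x)"
      by (simp add: Re_cinner[symmetric] cinner_scaleC_left)
    also have "\<dots> = inner (\<i> *\<^sub>C A x) x"
      using A by (simp add: complex_linear_op_def)
    also have "\<dots> = - Im (cinner x (A x))"
      by (simp add: Re_cinner[symmetric] cinner_scaleC_left cinner_commute[of "A x" x])
    finally show "Im (cinner x (A x)) = Im (complex_of_real (inner x (A x)))"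
      by simp
  qed (simp add: Re_cinner)
  then show "positive_op A"
    unfolding positive_op_def using A by blast
qed

lemma positive_opI:
  assumes "complex_linear_op A" "\<And>x y. inner x (A y) = inner (A x) y" "\<And>x. 0 \<le> inner x (A x)"
  shows "positive_op A"
  using assms by (simp add: positive_op_iff)

lemma positive_op_linear: "positive_op A \<Longrightarrow> complex_linear_op A"
  and positive_op_symmetric: "positive_op A \<Longrightarrow> inner x (A y) = inner (A x) y"
  and positive_op_nonneg: "positive_op A \<Longrightarrow> 0 \<le> inner x (A x)"
  by (auto simp: positive_op_iff)

lemma complex_linear_op_id: "complex_linear_op id_blinfun"
  and complex_linear_op_zero: "complex_linear_op 0"
  by (simp_all add: complex_linear_op_def scaleC_zero_right)

lemma complex_linear_op_add: "complex_linear_op A \<Longrightarrow> complex_linear_op B \<Longrightarrow> complex_linear_op (A + B)"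
  and complex_linear_op_diff: "complex_linear_op A \<Longrightarrow> complex_linear_op B \<Longrightarrow> complex_linear_op (A - B)"
  and complex_linear_op_compose: "complex_linear_op A \<Longrightarrow> complex_linear_op B \<Longrightarrow> complex_linear_op (A o\<^sub>L B)"
  by (simp_all add: complex_linear_op_def blinfun.add_left blinfun.diff_left scaleC_add_right
      scaleC_diff_right)

lemma complex_linear_op_scaleR: "complex_linear_op A \<Longrightarrow> complex_linear_op (r *\<^sub>R A)"
  unfolding complex_linear_op_def blinfun.scaleR_left
  by (metis mult.commute scaleC_of_real scaleC_scaleC)

lemma complex_linear_op_limit:
  assumes "S \<longlonglongrightarrow> A" and "\<And>n. complex_linear_op (S n)"
  shows "complex_linear_op A"
  unfolding complex_linear_op_def
proof (intro allI)
  fix c x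
  have "(\<lambda>n. blinfun_apply (S n) (c *\<^sub>C x)) \<longlonglongrightarrow> A (c *\<^sub>C x)"
    using assms(1) by (intro tendsto_intros)
  moreover have "(\<lambda>n. c *\<^sub>C blinfun_apply (S n) x) \<longlonglongrightarrow> c *\<^sub>C A x"
    using assms(1) by (intro scaleC_continuous tendsto_intros)
  ultimately show "A (c *\<^sub>C x) = c *\<^sub>C A x"
    using assms(2) LIMSEQ_unique by (simp add: complex_linear_op_def)
qed

lemma positive_op_id: "positive_op id_blinfun"
  by (intro positive_opI complex_linear_op_id) auto

lemma positive_op_zero: "positive_op 0"
  by (intro positive_opI complex_linear_op_zero) auto

lemma positive_op_add: "positive_op A \<Longrightarrow> positive_op B \<Longrightarrow> positive_op (A + B)"
  by (intro positive_opI)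
    (simp_all add: positive_op_linear complex_linear_op_add blinfun.add_left inner_add_left
      inner_add_right positive_op_symmetric[symmetric] positive_op_nonneg)

lemma positive_op_scaleR: "positive_op A \<Longrightarrow> 0 \<le> r \<Longrightarrow> positive_op (r *\<^sub>R A)"
  by (intro positive_opI)
    (simp_all add: positive_op_linear complex_linear_op_scaleR blinfun.scaleR_left
      positive_op_nonneg flip: positive_op_symmetric)

lemma positive_op_sum: "(\<And>i. i \<in> I \<Longrightarrow> positive_op (T i)) \<Longrightarrow> positive_op (sum T I)"
  by (induction I rule: infinite_finite_induct) (auto simp: positive_op_zero positive_op_add)

lemma positive_op_congruence:
  assumes "positive_op T" "complex_linear_op Q" "\<And>x y. inner x (Q y) = inner (Q x) y"
  shows "positive_op (Q o\<^sub>L T o\<^sub>L Q)"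
proof (rule positive_opI)
  show "complex_linear_op (Q o\<^sub>L T o\<^sub>L Q)"
    using assms by (intro complex_linear_op_compose) (simp_all add: positive_op_linear)
  show "0 \<le> inner x ((Q o\<^sub>L T o\<^sub>L Q) x)" for x
    using positive_op_nonneg[OF assms(1), of "Q x"] by (simp add: assms(3))
qed (simp add: assms(3) positive_op_symmetric[OF assms(1)])

lemma op_le_refl: "A \<le>\<^sub>o A"
  by (simp add: op_le_def positive_op_zero)

text \<open>The norm of a self-adjoint operator is its numerical radius. Polarization expresses
  \<open>inner x (T y)\<close> by the quadratic form at x + y and x - y, and the parallelogram law
  bounds the result; x is then the multiple of T y that is as long as y. Order bounds become norm
  bounds in this way.\<close>

lemma symmetric_norm_le:
  fixes T :: "'a::real_inner \<Rightarrow>\<^sub>L 'a"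
  assumes sym: "\<And>x y. inner x (T y) = inner (T x) y"
    and bound: "\<And>x. \<bar>inner x (T x)\<bar> \<le> c * inner x x"
    and c: "0 \<le> c"
  shows "norm T \<le> c"
proof -
  have polar: "2 * inner x (T y) \<le> c * (inner x x + inner y y)" for x y
  proof -
    have "inner (x + y) (T (x + y)) - inner (x - y) (T (x - y)) = 4 * inner x (T y)"
      by (simp add: blinfun.bilinear_simps inner_add_left inner_add_right inner_diff_left
          inner_diff_right sym[of y x] inner_commute[of "T y" x])
    moreover have "inner (x + y) (T (x + y)) - inner (x - y) (T (x - y))
        \<le> c * inner (x + y) (x + y) + c * inner (x - y) (x - y)"
      using bound[of "x + y"] bound[of "x - y"] by linarith
    moreover have "\<dots> = 2 * (c * (inner x x + inner y y))"
      by (simp add: inner_add_left inner_add_right inner_diff_left inner_diff_right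
          inner_commute algebra_simps)
    ultimately show ?thesis by linarith
  qed
  have "norm (T y) \<le> c * norm y" for y
  proof (cases "T y = 0 \<or> y = 0")
    case False
    define x where "x = (norm y / norm (T y)) *\<^sub>R T y"
    have "norm x = norm y"
      using False by (simp add: x_def)
    then have "inner x x = (norm y)\<^sup>2"
      by (simp add: dot_square_norm)
    moreover have "inner x (T y) = norm y * norm (T y)"
      using False by (simp add: x_def dot_square_norm power2_eq_square)
    ultimately have "norm y * norm (T y) \<le> norm y * (c * norm y)"
      using polar[of x y] by (simp add: dot_square_norm power2_eq_square algebra_simps)
    then show ?thesis
      using False by simp
  qed (use c in auto)
  then show ?thesis
    using c by (intro norm_blinfun_bound)
qed


section \<open>Polynomials of an operator\<close>

lemma poly_op_altdef:
  assumes "degree p \<le> n"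
  shows "poly_op p A = (\<Sum>i\<le>n. coeff p i *\<^sub>R (((o\<^sub>L) A ^^ i) id_blinfun))"
  unfolding poly_op_def using assms
  by (intro sum.mono_neutral_left) (auto simp: coeff_eq_0)

lemma poly_op_0 [simp]: "poly_op 0 A = 0"
  by (simp add: poly_op_def)

lemma poly_op_pCons [simp]: "poly_op (pCons a p) A = a *\<^sub>R id_blinfun + (A o\<^sub>L poly_op p A)"
proof -
  have "poly_op (pCons a p) A
      = (\<Sum>i\<le>Suc (degree p). coeff (pCons a p) i *\<^sub>R (((o\<^sub>L) A ^^ i) id_blinfun))"
    by (intro poly_op_altdef) (simp add: degree_pCons_le)
  also have "\<dots> = a *\<^sub>R id_blinfun
      + (\<Sum>i\<le>degree p. coeff p i *\<^sub>R (A o\<^sub>L ((o\<^sub>L) A ^^ i) id_blinfun))"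
    by (simp only: sum.atMost_Suc_shift) simp
  also have "(\<Sum>i\<le>degree p. coeff p i *\<^sub>R (A o\<^sub>L ((o\<^sub>L) A ^^ i) id_blinfun)) = A o\<^sub>L poly_op p A"
    by (simp add: poly_op_def bounded_bilinear.sum_right[OF bounded_bilinear_blinfun_compose]
        bounded_bilinear.scaleR_right[OF bounded_bilinear_blinfun_compose])
  finally show ?thesis .
qed

lemma blinfun_compose_add_left: "(A + B) o\<^sub>L C = (A o\<^sub>L C) + (B o\<^sub>L C)"
  and blinfun_compose_add_right: "C o\<^sub>L (A + B) = (C o\<^sub>L A) + (C o\<^sub>L B)"
  and blinfun_compose_scaleR_left: "(r *\<^sub>R A) o\<^sub>L C = r *\<^sub>R (A o\<^sub>L C)"
  and blinfun_compose_scaleR_right: "C o\<^sub>L (r *\<^sub>R A) = r *\<^sub>R (C o\<^sub>L A)"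
  and blinfun_compose_assoc: "(A o\<^sub>L B) o\<^sub>L C = A o\<^sub>L (B o\<^sub>L C)"
  and blinfun_compose_id_left [simp]: "id_blinfun o\<^sub>L A = A"
  and blinfun_compose_id_right [simp]: "A o\<^sub>L id_blinfun = A"
  by (auto intro!: blinfun_eqI simp: blinfun.bilinear_simps)

lemma poly_op_add: "poly_op (p + q) A = poly_op p A + poly_op q A"
proof (induction p q rule: poly_induct2)
  case (pCons a p b q)
  then show ?case
    by (simp add: blinfun_compose_add_right algebra_simps)
qed simp

lemma poly_op_smult: "poly_op (smult r p) A = r *\<^sub>R poly_op p A"
  by (induction p) (simp_all add: blinfun_compose_scaleR_right scaleR_add_right)

lemma poly_op_diff: "poly_op (p - q) A = poly_op p A - poly_op q A"
  using poly_op_add[of "p - q" q A] by simp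

lemma poly_op_sum: "poly_op (\<Sum>i\<in>I. p i) A = (\<Sum>i\<in>I. poly_op (p i) A)"
  by (induction I rule: infinite_finite_induct) (simp_all add: poly_op_add)

lemma poly_op_mult: "poly_op (p * q) A = poly_op p A o\<^sub>L poly_op q A"
  by (induction p)
    (simp_all add: poly_op_add poly_op_smult blinfun_compose_add_left blinfun_compose_scaleR_left
      blinfun_compose_assoc)

lemma poly_op_linear:
  assumes "complex_linear_op A"
  shows "complex_linear_op (poly_op p A)"
  by (induction p)
    (auto intro!: complex_linear_op_add complex_linear_op_scaleR complex_linear_op_compose assms
      complex_linear_op_id complex_linear_op_zero)

lemma poly_op_commute: "A o\<^sub>L poly_op p A = poly_op p A o\<^sub>L A"
  using poly_op_mult[of p "[:0, 1:]" A] poly_op_mult[of "[:0, 1:]" p A]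
  by (simp add: mult.commute)

lemma poly_op_symmetric:
  fixes A :: "'a::complex_hilbert_space \<Rightarrow>\<^sub>L 'a"
  assumes "\<And>x y. inner x (A y) = inner (A x) y"
  shows "inner x (poly_op p A y) = inner (poly_op p A x) y"
proof (induction p arbitrary: x y)
  case (pCons a p)
  have "poly_op p A (A x) = A (poly_op p A x)"
    by (metis poly_op_commute blinfun_apply_blinfun_compose)
  with pCons(2)[of "A x" y] show ?case
    by (simp add: blinfun.bilinear_simps inner_add_left inner_add_right assms)
qed simp

lemma poly_op_continuous:
  assumes "A \<longlonglongrightarrow> B"
  shows "(\<lambda>n. poly_op p (A n)) \<longlonglongrightarrow> poly_op p B"
  by (induction p)
    (auto intro!: tendsto_intros assms bounded_bilinear.tendsto[OF bounded_bilinear_blinfun_compose])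

section \<open>Positivity of polynomials of a positive contraction\<close>

text \<open>The even parts of both exponents split off symmetrically as a congruence, which
  preserves positivity, so only exponents 0 and 1 remain.\<close>

lemma positive_op_power_products:
  assumes "positive_op A" "positive_op (id_blinfun - A)"
  shows "positive_op (poly_op ([:0, 1:] ^ k * [:1, -1:] ^ m) A)"
proof -
  have sym: "inner x (poly_op q A y) = inner (poly_op q A x) y" for q x y
    by (intro poly_op_symmetric positive_op_symmetric assms)
  have lin: "complex_linear_op (poly_op q A)" for q
    by (intro poly_op_linear positive_op_linear assms)
  have square: "positive_op (poly_op (q * p * q) A)" if "positive_op (poly_op p A)" for p q
    unfolding poly_op_mult by (intro positive_op_congruence that sym lin)
  have YA: "poly_op [:1, -1:] A = id_blinfun - A"
    by (intro blinfun_eqI) (simp add: blinfun.bilinear_simps)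
  have X: "positive_op (poly_op [:0, 1:] A)" and Y: "positive_op (poly_op [:1, -1:] A)"
    using assms by (simp, simp only: YA)
  \<comment> \<open>The one mixed case: the two factors sum to 1, and multiplying their product by
    this sum gives two congruences of positive operators.\<close>
  have "[:0, 1:] * [:1, -1:] = [:0, 1:] * [:1, -1:] * [:0, 1:] + [:1, -1:] * [:0, 1:] * ([:1, -1:] :: real poly)"
    by simp
  then have "positive_op (poly_op ([:0, 1:] * [:1, -1:]) A)"
    using positive_op_add[OF square[OF Y, of "[:0, 1:]"] square[OF X, of "[:1, -1:]"]]
    by (metis poly_op_add)
  then have base: "positive_op (poly_op ([:0, 1:] ^ (k mod 2) * [:1, -1:] ^ (m mod 2)) A)"
    using X Y positive_op_id by (cases "even k"; cases "even m")
      (simp_all add: even_iff_mod_2_eq_zero odd_iff_mod_2_eq_one one_pCons)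
  have split: "(x :: real poly) ^ k = x ^ (k div 2) * x ^ (k mod 2) * x ^ (k div 2)" for x k
  proof -
    have "k = k div 2 + k mod 2 + k div 2" by presburger
    then show ?thesis by (metis power_add)
  qed
  have regroup: "(u * r * u) * (v * s * v) = (u * v) * (r * s) * (u * v)" for u v r s :: "real poly"
    by (simp only: mult_ac)
  show ?thesis
    by (subst split[of _ k], subst split[of _ m], subst regroup) (rule square[OF base])
qed

text \<open>The quotient is the k-th Bernstein coefficient of x^i at level n. It is the product of
  the factors (k - j)/(n - j) for j < i, each within d/(n - d) of k/n, so the error grows by at most
  this amount per factor. The bound is uniform in k.\<close>

lemma binomial_quotient_power:
  fixes k n i d :: nat
  assumes "i \<le> d" "d < n" "k \<le> n"
  shows "\<bar>real (k choose i) / real (n choose i) - (k / n) ^ i\<bar> \<le> i * (d / (n - d))"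
  using assms(1)
proof (induction i)
  case (Suc i)
  let ?r = "\<lambda>i. real (k choose i) / real (n choose i)" and ?s = "real k / real n"
  have s: "0 \<le> ?s" "?s \<le> 1"
    using assms by auto
  have rec: "real (m choose Suc i) = real (m choose i) * (real m - real i) / real (Suc i)" for m
  proof (cases "i \<le> m")
    case True
    have "Suc i * (m choose Suc i) = (m choose i) * (m - i)"
      by (metis binomial_absorb_comp binomial_absorption mult.commute)
    then have "real (Suc i) * real (m choose Suc i) = real (m choose i) * (real m - real i)"
      using True by (metis of_nat_diff of_nat_mult)
    then show ?thesis
      by (simp add: field_simps del: of_nat_Suc)
  qed (simp add: binomial_eq_0)
  have step: "?r (Suc i) = ?r i * ((real k - i) / (real n - i))"
    unfolding rec[of k] rec[of n] by (simp del: of_nat_Suc)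
  have IH: "\<bar>?r i - ?s ^ i\<bar> \<le> i * (d / (n - d))"
    using Suc by simp
  have d0: "0 \<le> real d / real (n - d)"
    by simp
  show ?case
  proof (cases "i \<le> k")
    \<comment> \<open>Beyond k both quotients are 0, so the error is just a power of k/n, which
      decreases in the exponent.\<close>
    case False
    then have r0: "?r (Suc i) = 0" "?r i = 0"
      by (simp_all add: binomial_eq_0)
    have "?s ^ Suc i \<le> ?s ^ i" "0 \<le> ?s ^ Suc i"
      using s power_decreasing[of i "Suc i" ?s] by (simp_all del: power_Suc)
    then have "\<bar>?r (Suc i) - ?s ^ Suc i\<bar> \<le> \<bar>?r i - ?s ^ i\<bar>"
      unfolding r0 by linarith
    also have "\<dots> \<le> Suc i * (d / (n - d))"
      using d0 by (intro order.trans[OF IH] mult_right_mono) auto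
    finally show ?thesis .
  next
    case True
    let ?q = "(real k - i) / (real n - i)"
    have ni: "0 < real n - i" "i < n"
      using Suc.prems assms by auto
    have q: "0 \<le> ?q" "?q \<le> 1"
      using True ni assms by auto
    have "?s - ?q = i * (real n - k) / (n * (real n - i))"
      using ni by (simp add: field_simps)
    also have "\<dots> = (i / (real n - i)) * ((real n - k) / n)"
      by simp
    finally have diff: "?s - ?q = (i / (real n - i)) * ((real n - k) / n)" .
    have "(i / (real n - i)) * ((real n - k) / n) \<le> (i / (real n - i)) * 1"
      using ni assms by (intro mult_left_mono) auto
    also have "\<dots> \<le> d / (n - d)"
      using ni assms Suc.prems by (auto intro!: frac_le simp: of_nat_diff)
    finally have "?s - ?q \<le> d / (n - d)"
      using diff by simp
    moreover have "0 \<le> ?s - ?q"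
      unfolding diff using ni assms by simp
    ultimately have sq: "\<bar>?q - ?s\<bar> \<le> d / (n - d)"
      by (simp only: abs_minus_commute[of ?q] abs_of_nonneg)
    \<comment> \<open>Telescoping: the old error times a factor in [0, 1], plus the error of the new
      factor times a power in [0, 1].\<close>
    have "?r (Suc i) - ?s ^ Suc i = ?q * (?r i - ?s ^ i) + ?s ^ i * (?q - ?s)"
      unfolding step by (simp add: algebra_simps)
    also have "\<bar>\<dots>\<bar> \<le> \<bar>?q * (?r i - ?s ^ i)\<bar> + \<bar>?s ^ i * (?q - ?s)\<bar>"
      by (rule abs_triangle_ineq)
    also have "\<dots> \<le> 1 * \<bar>?r i - ?s ^ i\<bar> + 1 * \<bar>?q - ?s\<bar>"
      unfolding abs_mult abs_of_nonneg[OF q(1)] abs_of_nonneg[OF zero_le_power[OF s(1)]]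
      using q s by (intro add_mono mult_right_mono) (simp_all add: power_le_one)
    also have "\<dots> \<le> i * (d / (n - d)) + d / (n - d)"
      unfolding mult_1 by (intro add_mono IH sq)
    also have "\<dots> = Suc i * (d / (n - d))"
      by (simp add: distrib_right add_divide_distrib)
    finally show ?thesis .
  qed
qed simp

text \<open>The function \<open>Bernstein n k\<close> as a polynomial object, to which
  \<open>poly_op\<close> applies; its shape is that of
  \<open>positive_op_power_products\<close>.\<close>

definition bernstein_basis :: "nat \<Rightarrow> nat \<Rightarrow> real poly"
  where "bernstein_basis n k = smult (n choose k) ([:0, 1:] ^ k * [:1, -1:] ^ (n - k))"

lemma poly_bernstein_basis: "poly (bernstein_basis n k) x = Bernstein n k x"
  by (simp add: bernstein_basis_def Bernstein_def)

text \<open>By (n choose k)(k choose i) = (n choose i)(n - i choose k - i), the sum is x^i times the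
  binomial expansion of (x + (1 - x))^(n - i).\<close>

lemma power_bernstein_expansion:
  assumes "i \<le> n"
  shows "(\<Sum>k\<le>n. (real (k choose i) / real (n choose i)) * Bernstein n k x) = x ^ i"
proof -
  have "(\<Sum>k\<le>n. (real (k choose i) / real (n choose i)) * Bernstein n k x)
      = (\<Sum>k\<in>{i..n}. real ((n - i) choose (k - i)) * x ^ k * (1 - x) ^ (n - k))"
  proof (rule sum.mono_neutral_cong_right)
    fix k assume k: "k \<in> {i..n}"
    then have "(n choose k) * (k choose i) = (n choose i) * ((n - i) choose (k - i))"
      using choose_mult[of i k n] by simp
    then have "real (k choose i) * real (n choose k) = real (n choose i) * real ((n - i) choose (k - i))"
      by (metis of_nat_mult mult.commute)
    moreover have "real (n choose i) \<noteq> 0"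
      using assms by simp
    ultimately have "(real (k choose i) / real (n choose i)) * real (n choose k) = real ((n - i) choose (k - i))"
      by (simp add: field_simps)
    then show "(real (k choose i) / real (n choose i)) * Bernstein n k x
        = real ((n - i) choose (k - i)) * x ^ k * (1 - x) ^ (n - k)"
      by (simp add: Bernstein_def mult.assoc[symmetric])
  qed (auto simp: binomial_eq_0)
  also have "\<dots> = (\<Sum>j\<le>n - i. real ((n - i) choose j) * x ^ (j + i) * (1 - x) ^ (n - i - j))"
    using assms by (intro sum.reindex_bij_witness[of _ "\<lambda>j. j + i" "\<lambda>k. k - i"]) auto
  also have "\<dots> = x ^ i * (\<Sum>j\<le>n - i. Bernstein (n - i) j x)"
    by (simp add: Bernstein_def sum_distrib_left power_add mult_ac)
  finally show ?thesis by simp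
qed

text \<open>The Bernstein coefficients of p at level n are close to the values p(k/n), which are
  nonnegative. Adding a small constant therefore makes p a nonnegative combination of the products
  known to be positive, and the constant tends to 0.\<close>

lemma poly_op_nonneg:
  assumes A: "positive_op A" "positive_op (id_blinfun - A)"
    and p: "\<And>a. 0 \<le> a \<Longrightarrow> a \<le> 1 \<Longrightarrow> 0 \<le> poly p a"
  shows "0 \<le> inner x (poly_op p A x)"
proof -
  define d where "d = degree p"
  \<comment> \<open>The errors from \<open>binomial_quotient_power\<close>, with the factor i
    enlarged to d, weighted by the coefficients of p.\<close>
  define \<delta> where "\<delta> = (\<lambda>n :: nat. \<Sum>i\<le>d. \<bar>coeff p i\<bar> * (d * (d / (n - d))))"
  \<comment> \<open>The exact Bernstein coefficients of p at level n, by
    \<open>power_bernstein_expansion\<close>.\<close>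
  define c where "c n k = (\<Sum>i\<le>d. coeff p i * (real (k choose i) / real (n choose i)))" for n k
  have c_nonneg: "0 \<le> c n k + \<delta> n" if "k \<le> n" "d < n" for n k
  proof -
    have "poly p (k / n) - c n k = (\<Sum>i\<le>d. coeff p i * ((k / n) ^ i - real (k choose i) / real (n choose i)))"
      by (simp add: poly_altdef c_def d_def sum_subtractf right_diff_distrib)
    also have "\<dots> \<le> \<delta> n"
      unfolding \<delta>_def
    proof (intro sum_mono)
      fix i assume i: "i \<in> {..d}"
      have "coeff p i * ((k / n) ^ i - real (k choose i) / real (n choose i))
          \<le> \<bar>coeff p i\<bar> * \<bar>(k / n) ^ i - real (k choose i) / real (n choose i)\<bar>"
        by (metis abs_ge_self abs_mult)
      also have "\<dots> \<le> \<bar>coeff p i\<bar> * (i * (d / (n - d)))"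
        using binomial_quotient_power[of i d n k] i that
        by (intro mult_left_mono) (auto simp: abs_minus_commute)
      also have "\<dots> \<le> \<bar>coeff p i\<bar> * (d * (d / (n - d)))"
        using i by (intro mult_left_mono mult_right_mono) auto
      finally show "coeff p i * ((k / n) ^ i - real (k choose i) / real (n choose i))
          \<le> \<bar>coeff p i\<bar> * (d * (d / (n - d)))" .
    qed
    finally show ?thesis
      using p[of "k / n"] that by simp
  qed
  have expand: "p + [:\<delta> n:] = (\<Sum>k\<le>n. smult (c n k + \<delta> n) (bernstein_basis n k))" if "d < n" for n
  proof (rule poly_eq_poly_eq_iff[THEN iffD1], rule ext)
    fix a :: real
    have "poly p a = (\<Sum>i\<le>d. coeff p i * a ^ i)"
      by (simp add: poly_altdef d_def)
    also have "\<dots> = (\<Sum>i\<le>d. coeff p i * (\<Sum>k\<le>n. (real (k choose i) / real (n choose i)) * Bernstein n k a))"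
    proof (intro sum.cong refl)
      fix i assume "i \<in> {..d}"
      then have "i \<le> n" using that by simp
      then show "coeff p i * a ^ i = coeff p i * (\<Sum>k\<le>n. (real (k choose i) / real (n choose i)) * Bernstein n k a)"
        by (simp only: power_bernstein_expansion)
    qed
    also have "\<dots> = (\<Sum>k\<le>n. c n k * Bernstein n k a)"
      unfolding c_def sum_distrib_left sum_distrib_right
      by (subst sum.swap) (simp only: mult_ac)
    finally show "poly (p + [:\<delta> n:]) a = poly (\<Sum>k\<le>n. smult (c n k + \<delta> n) (bernstein_basis n k)) a"
      by (simp add: poly_sum poly_bernstein_basis distrib_right sum.distrib flip: sum_distrib_left)
  qed
  have lower: "- (\<delta> n * inner x x) \<le> inner x (poly_op p A x)" if "d < n" for n
  proof -
    have "positive_op (poly_op (p + [:\<delta> n:]) A)"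
      unfolding expand[OF that] poly_op_sum poly_op_smult bernstein_basis_def
      using c_nonneg that
      by (intro positive_op_sum positive_op_scaleR positive_op_power_products A) auto
    from positive_op_nonneg[OF this, of x] show ?thesis
      by (simp add: poly_op_add blinfun.bilinear_simps inner_add_right)
  qed
  \<comment> \<open>Shifting the index by d removes the truncated subtraction n - d.\<close>
  have "(\<lambda>n. real d / real (n + d - d)) \<longlonglongrightarrow> 0"
    using lim_const_over_n[of "real d"] by simp
  then have "(\<lambda>n. real d / real (n - d)) \<longlonglongrightarrow> 0"
    by (rule LIMSEQ_offset[where k = d])
  then have "\<delta> \<longlonglongrightarrow> (\<Sum>i\<le>d. \<bar>coeff p i\<bar> * (real d * 0))"
    unfolding \<delta>_def by (intro tendsto_sum) (intro tendsto_mult_left)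
  then have "\<delta> \<longlonglongrightarrow> 0" by simp
  from tendsto_minus[OF tendsto_mult_right[OF this, of "inner x x"]]
  have "(\<lambda>n. - (\<delta> n * inner x x)) \<longlonglongrightarrow> - (0 * inner x x)" .
  then have "- (0 * inner x x) \<le> inner x (poly_op p A x)"
    by (rule LIMSEQ_le_const2) (metis lower Suc_le_eq)
  then show ?thesis by simp
qed

text \<open>Both c - p and c + p are nonnegative on the unit interval, which traps the quadratic
  form of p(A) between -c and c times that of the identity.\<close>

lemma poly_op_norm_le:
  assumes A: "positive_op A" "positive_op (id_blinfun - A)"
    and p: "\<And>a. 0 \<le> a \<Longrightarrow> a \<le> 1 \<Longrightarrow> \<bar>poly p a\<bar> \<le> c"
  shows "norm (poly_op p A) \<le> c"
proof (rule symmetric_norm_le)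
  show "inner x (poly_op p A y) = inner (poly_op p A x) y" for x y
    by (intro poly_op_symmetric positive_op_symmetric A)
  show "\<bar>inner x (poly_op p A x)\<bar> \<le> c * inner x x" for x
  proof -
    have "0 \<le> poly ([:c:] - p) a" "0 \<le> poly ([:c:] + p) a" if "0 \<le> a" "a \<le> 1" for a
      using p[OF that] by (simp_all add: abs_le_iff)
    then have "0 \<le> inner x (poly_op ([:c:] - p) A x)" "0 \<le> inner x (poly_op ([:c:] + p) A x)"
      by (auto intro!: poly_op_nonneg[OF A])
    then show ?thesis
      by (simp add: poly_op_add poly_op_diff blinfun.bilinear_simps inner_add_right
          inner_diff_right abs_le_iff)
  qed
  show "0 \<le> c"
    using p[of 0] by simp
qed


section \<open>Continuous functional calculus on the unit interval\<close>

text \<open>The unit interval takes the place of the spectrum, which \<open>poly_op_norm_le\<close>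
  justifies for operators between 0 and I. It is a relation because existence depends on g
  (\<open>calculus_exists\<close>) and uniqueness on A (\<open>calculus_unique\<close>).\<close>

definition calculus :: "('a::complex_hilbert_space \<Rightarrow>\<^sub>L 'a) \<Rightarrow> (real \<Rightarrow> real) \<Rightarrow> ('a \<Rightarrow>\<^sub>L 'a) \<Rightarrow> bool"
  where "calculus A g G \<longleftrightarrow> (\<exists>q. uniform_limit {0..1} (\<lambda>n. poly (q n)) g sequentially \<and>
    (\<lambda>n. poly_op (q n) A) \<longlonglongrightarrow> G)"

text \<open>Neither p nor c depends on A: one polynomial approximates g at all positive contractions
  with the same error, which later allows the operator to vary.\<close>

lemma calculus_norm_le:
  assumes A: "positive_op A" "positive_op (id_blinfun - A)"
    and G: "calculus A g G"
    and p: "\<And>a. 0 \<le> a \<Longrightarrow> a \<le> 1 \<Longrightarrow> \<bar>poly p a - g a\<bar> \<le> c"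
  shows "norm (poly_op p A - G) \<le> c"
proof -
  obtain q where q: "uniform_limit {0..1} (\<lambda>n. poly (q n)) g sequentially" "(\<lambda>n. poly_op (q n) A) \<longlonglongrightarrow> G"
    using G by (auto simp: calculus_def)
  have "norm (poly_op p A - G) \<le> c + e" if "e > 0" for e
  proof -
    have "\<forall>\<^sub>F n in sequentially. norm (poly_op p A - poly_op (q n) A) \<le> c + e"
      using uniform_limitD[OF q(1) that]
    proof eventually_elim
      case (elim n)
      have "norm (poly_op (p - q n) A) \<le> c + e"
      proof (rule poly_op_norm_le[OF A])
        fix a :: real assume "0 \<le> a" "a \<le> 1"
        then show "\<bar>poly (p - q n) a\<bar> \<le> c + e"
          using p[of a] elim[rule_format, of a] by (simp add: dist_real_def)
      qed
      then show ?case by (simp add: poly_op_diff)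
    qed
    then show ?thesis
      using q(2) by (intro tendsto_upperbound[of "\<lambda>n. norm (poly_op p A - poly_op (q n) A)"])
        (auto intro!: tendsto_intros)
  qed
  then show ?thesis
    by (rule field_le_epsilon)
qed

lemma calculus_tendsto:
  assumes A: "positive_op A" "positive_op (id_blinfun - A)"
    and G: "calculus A g G" and p: "uniform_limit {0..1} (\<lambda>n. poly (p n)) g sequentially"
  shows "(\<lambda>n. poly_op (p n) A) \<longlonglongrightarrow> G"
proof (rule tendstoI)
  fix e :: real assume "e > 0"
  then have "\<forall>\<^sub>F n in sequentially. \<forall>a\<in>{0..1}. dist (poly (p n) a) (g a) < e / 2"
    using uniform_limitD[OF p, of "e / 2"] by simp
  then show "\<forall>\<^sub>F n in sequentially. dist (poly_op (p n) A) G < e"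
  proof eventually_elim
    case (elim n)
    have "norm (poly_op (p n) A - G) \<le> e / 2"
    proof (rule calculus_norm_le[OF A G])
      fix a :: real assume "0 \<le> a" "a \<le> 1"
      then show "\<bar>poly (p n) a - g a\<bar> \<le> e / 2"
        using elim[rule_format, of a] by (simp add: dist_real_def)
    qed
    with \<open>e > 0\<close> show ?case by (simp add: dist_norm)
  qed
qed

lemma calculus_unique:
  assumes A: "positive_op A" "positive_op (id_blinfun - A)"
    and "calculus A g G" "calculus A g H"
  shows "G = H"
proof -
  obtain q where "uniform_limit {0..1} (\<lambda>n. poly (q n)) g sequentially" "(\<lambda>n. poly_op (q n) A) \<longlonglongrightarrow> H"
    using assms(4) by (auto simp: calculus_def)
  then show ?thesis
    using calculus_tendsto[OF A assms(3)] LIMSEQ_unique by blast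
qed

lemma calculus_poly: "calculus A (poly p) (poly_op p A)"
  unfolding calculus_def by (intro exI[of _ "\<lambda>_. p"]) (auto intro: uniform_limit_const)

lemma calculus_cong:
  assumes "calculus A g G" and eq: "\<And>a. 0 \<le> a \<Longrightarrow> a \<le> 1 \<Longrightarrow> g a = h a"
  shows "calculus A h G"
proof -
  have "uniform_limit {0..1} F g sequentially = uniform_limit {0..1} F h sequentially" for F :: "nat \<Rightarrow> real \<Rightarrow> real"
    by (rule uniform_limit_cong') (simp_all add: eq)
  with assms(1) show ?thesis
    by (simp add: calculus_def)
qed

lemma calculus_add:
  assumes "calculus A g G" "calculus A h H"
  shows "calculus A (\<lambda>a. g a + h a) (G + H)"
proof -
  obtain p q where pq: "uniform_limit {0..1} (\<lambda>n. poly (p n)) g sequentially" "(\<lambda>n. poly_op (p n) A) \<longlonglongrightarrow> G"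
    "uniform_limit {0..1} (\<lambda>n. poly (q n)) h sequentially" "(\<lambda>n. poly_op (q n) A) \<longlonglongrightarrow> H"
    using assms by (auto simp: calculus_def)
  have add: "poly (p n + q n) = (\<lambda>x. poly (p n) x + poly (q n) x)" for n
    by auto
  then show ?thesis
    unfolding calculus_def
    using uniform_limit_add[OF pq(1,3)] tendsto_add[OF pq(2,4)]
    by (intro exI[of _ "\<lambda>n. p n + q n"]) (simp add: poly_op_add add)
qed

lemma calculus_mult:
  assumes "calculus A g G" "calculus A h H" "continuous_on {0..1} g" "continuous_on {0..1} h"
  shows "calculus A (\<lambda>a. g a * h a) (G o\<^sub>L H)"
proof -
  obtain p q where pq: "uniform_limit {0..1} (\<lambda>n. poly (p n)) g sequentially" "(\<lambda>n. poly_op (p n) A) \<longlonglongrightarrow> G"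
    "uniform_limit {0..1} (\<lambda>n. poly (q n)) h sequentially" "(\<lambda>n. poly_op (q n) A) \<longlonglongrightarrow> H"
    using assms by (auto simp: calculus_def)
  have "bounded (g ` {0..1})" "bounded (h ` {0..1})"
    using assms by (auto intro!: compact_imp_bounded compact_continuous_image)
  moreover have mult: "poly (p n * q n) = (\<lambda>x. poly (p n) x * poly (q n) x)" for n
    by auto
  ultimately show ?thesis
    unfolding calculus_def
    using uniform_lim_mult[OF pq(1,3)] bounded_bilinear.tendsto[OF bounded_bilinear_blinfun_compose pq(2,4)]
    by (intro exI[of _ "\<lambda>n. p n * q n"]) (simp add: poly_op_mult mult)
qed

lemma calculus_poly_compose:
  assumes "calculus A g G" "continuous_on {0..1} g"
  shows "calculus A (\<lambda>a. poly p (g a)) (poly_op p G)"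
proof (induction p)
  case 0
  have "calculus A (poly 0) (poly_op 0 G)" using calculus_poly[of A 0] by simp
  then show ?case by (rule calculus_cong) simp
next
  case (pCons c p)
  have "calculus A (\<lambda>a. poly [:c:] a + g a * poly p (g a)) (poly_op [:c:] A + (G o\<^sub>L poly_op p G))"
    by (intro calculus_add calculus_mult calculus_poly pCons assms continuous_intros)
  then show ?case by simp
qed

section \<open>Bernstein approximation and existence of the calculus\<close>

text \<open>Among the approximants, this one is linear in g and sees g only at the nodes k/n, so an
  integral over a parameter of g can be pulled through it.\<close>

definition bernstein_poly :: "nat \<Rightarrow> (real \<Rightarrow> real) \<Rightarrow> real poly"
  where "bernstein_poly n g = (\<Sum>k\<le>n. smult (g (k / n)) (bernstein_basis n k))"

lemma poly_bernstein_poly: "poly (bernstein_poly n g) x = (\<Sum>k\<le>n. g (k / n) * Bernstein n k x)"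
  by (simp add: bernstein_poly_def poly_sum poly_bernstein_basis)

lemma uniform_limit_bernstein_poly:
  assumes "continuous_on {0..1} g"
  shows "uniform_limit {0..1} (\<lambda>n. poly (bernstein_poly n g)) g sequentially"
proof (rule uniform_limitI)
  fix e :: real assume "e > 0"
  from Bernstein_Weierstrass[OF assms this]
  obtain N where N: "\<And>n x. N \<le> n \<Longrightarrow> x \<in> {0..1} \<Longrightarrow> \<bar>g x - (\<Sum>k\<le>n. g(k/n) * Bernstein n k x)\<bar> < e"
    by blast
  then show "\<forall>\<^sub>F n in sequentially. \<forall>x\<in>{0..1}. dist (poly (bernstein_poly n g) x) (g x) < e"
    unfolding eventually_sequentially
    by (intro exI[of _ N]) (simp add: poly_bernstein_poly dist_real_def abs_minus_commute)
qed

lemma calculus_exists: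
  fixes A :: "'a::complex_hilbert_space \<Rightarrow>\<^sub>L 'a"
  assumes A: "positive_op A" "positive_op (id_blinfun - A)"
    and g: "continuous_on {0..1} g"
  obtains G where "calculus A g G"
proof -
  let ?b = "\<lambda>n. bernstein_poly n g"
  have "Cauchy (\<lambda>n. poly_op (?b n) A)"
  proof (rule metric_CauchyI)
    fix e :: real assume "e > 0"
    then have "e / 2 > 0" by simp
    have "uniformly_Cauchy_on {0..1} (\<lambda>n. poly (?b n))"
      by (intro uniformly_convergent_Cauchy uniformly_convergentI[OF uniform_limit_bernstein_poly[OF g]])
    with \<open>e / 2 > 0\<close> obtain N where
      N: "\<forall>x\<in>{0..1}. \<forall>m\<ge>N. \<forall>n\<ge>N. dist (poly (?b m) x) (poly (?b n) x) < e / 2"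
      unfolding uniformly_Cauchy_on_def by blast
    have "dist (poly_op (?b m) A) (poly_op (?b n) A) < e" if "N \<le> m" "N \<le> n" for m n
    proof -
      have "norm (poly_op (?b m - ?b n) A) \<le> e / 2"
      proof (rule poly_op_norm_le[OF A])
        fix a :: real assume "0 \<le> a" "a \<le> 1"
        then show "\<bar>poly (?b m - ?b n) a\<bar> \<le> e / 2"
          using N[rule_format, of a m n] that by (simp add: dist_real_def)
      qed
      then show ?thesis
        using \<open>e > 0\<close> by (simp add: poly_op_diff dist_norm)
    qed
    then show "\<exists>N. \<forall>m\<ge>N. \<forall>n\<ge>N. dist (poly_op (?b m) A) (poly_op (?b n) A) < e"
      by blast
  qed
  then obtain G where "(\<lambda>n. poly_op (?b n) A) \<longlonglongrightarrow> G"
    using Cauchy_convergent convergent_def by blast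
  then show thesis
    using uniform_limit_bernstein_poly[OF g] by (intro that) (auto simp: calculus_def)
qed

lemma calculus_symmetric:
  assumes A: "positive_op A" and G: "calculus A g G"
  shows "inner x (G y) = inner (G x) y"
proof -
  obtain q where q: "(\<lambda>n. poly_op (q n) A) \<longlonglongrightarrow> G"
    using G by (auto simp: calculus_def)
  have "(\<lambda>n. inner x (poly_op (q n) A y)) \<longlonglongrightarrow> inner x (G y)"
    "(\<lambda>n. inner (poly_op (q n) A x) y) \<longlonglongrightarrow> inner (G x) y"
    using q by (auto intro!: tendsto_intros)
  then show ?thesis
    unfolding poly_op_symmetric[OF positive_op_symmetric[OF A]] by (rule LIMSEQ_unique)
qed

lemma calculus_linear:
  assumes A: "positive_op A" and G: "calculus A g G"
  shows "complex_linear_op G"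
  using G complex_linear_op_limit[OF _ poly_op_linear[OF positive_op_linear[OF A]]]
  by (auto simp: calculus_def)


section \<open>Inverses and square roots\<close>

text \<open>The quadratic form of B - A vanishes, and a self-adjoint operator with vanishing
  quadratic form is 0.\<close>

lemma op_le_antisym:
  assumes "A \<le>\<^sub>o B" "B \<le>\<^sub>o A"
  shows "A = B"
proof -
  have "norm (B - A) \<le> 0"
  proof (rule symmetric_norm_le)
    show "inner x ((B - A) y) = inner ((B - A) x) y" for x y
      using assms(1) by (simp add: op_le_def positive_op_symmetric)
    have "0 \<le> inner x ((B - A) x)" "0 \<le> inner x ((A - B) x)" for x
      using assms positive_op_nonneg unfolding op_le_def by blast+
    then show "\<bar>inner x ((B - A) x)\<bar> \<le> 0 * inner x x" for x
      by (smt (verit) blinfun.diff_left inner_diff_right mult_zero_left)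
  qed simp
  then show ?thesis by simp
qed

lemma op_le_congruence:
  assumes "X \<le>\<^sub>o Y" "positive_op S"
  shows "S o\<^sub>L X o\<^sub>L S \<le>\<^sub>o S o\<^sub>L Y o\<^sub>L S"
proof -
  have "(S o\<^sub>L Y o\<^sub>L S) - (S o\<^sub>L X o\<^sub>L S) = S o\<^sub>L (Y - X) o\<^sub>L S"
    by (intro blinfun_eqI) (simp add: blinfun.bilinear_simps)
  then show ?thesis
    unfolding op_le_def using assms
    by (simp only: op_le_def positive_op_congruence positive_op_linear positive_op_symmetric)
qed

lemma is_op_inverseI:
  assumes "A o\<^sub>L R = id_blinfun" "L o\<^sub>L A = id_blinfun"
  shows "is_op_inverse A R"
proof -
  have "L = L o\<^sub>L (A o\<^sub>L R)"
    using assms(1) by simp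
  also have "\<dots> = R"
    by (simp only: blinfun_compose_assoc[symmetric] assms(2) blinfun_compose_id_left)
  finally show ?thesis
    using assms by (simp add: is_op_inverse_def)
qed

lemma is_op_inverse_sym: "is_op_inverse A B \<Longrightarrow> is_op_inverse B A"
  by (simp add: is_op_inverse_def)

lemma is_op_inverse_apply:
  assumes "is_op_inverse A B"
  shows "A (B x) = x" "B (A x) = x"
  using assms unfolding is_op_inverse_def
  by (metis blinfun_apply_blinfun_compose blinfun_apply_id_blinfun id_apply)+

lemma op_inverse_eq:
  assumes "is_op_inverse A B"
  shows "op_inverse A = B"
  unfolding op_inverse_def
proof (rule the_equality)
  fix C assume "is_op_inverse A C"
  then show "C = B"
    using assms by (intro blinfun_eqI) (metis is_op_inverse_apply)
qed (rule assms)

lemma op_inverse_works: "op_invertible A \<Longrightarrow> is_op_inverse A (op_inverse A)"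
  using op_inverse_eq unfolding op_invertible_def by metis

lemma is_op_inverse_compose:
  assumes "is_op_inverse A A'" "is_op_inverse B B'"
  shows "is_op_inverse (A o\<^sub>L B) (B' o\<^sub>L A')"
  unfolding is_op_inverse_def
  by (intro conjI blinfun_eqI)
    (simp_all add: is_op_inverse_apply[OF assms(1)] is_op_inverse_apply[OF assms(2)])

lemma strictly_positive_op_id: "strictly_positive_op id_blinfun"
  by (auto simp: strictly_positive_op_def positive_op_id op_invertible_def is_op_inverse_def)

lemma op_inverse_id [simp]: "op_inverse id_blinfun = id_blinfun"
  by (intro op_inverse_eq) (simp add: is_op_inverse_def)

lemma positive_op_inverse:
  assumes "positive_op A" "is_op_inverse A B"
  shows "positive_op B"
proof (rule positive_opI)
  note inv = is_op_inverse_apply[OF assms(2)] and sym = positive_op_symmetric[OF assms(1)]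
  show "complex_linear_op B"
    using positive_op_linear[OF assms(1)] unfolding complex_linear_op_def by (metis inv)
  show "inner x (B y) = inner (B x) y" for x y
    by (metis inv(1) sym)
  show "0 \<le> inner x (B x)" for x
    by (metis inv(1) sym positive_op_nonneg[OF assms(1)])
qed

text \<open>The rescaling that brings an arbitrary positive operator into the range of
  \<open>calculus\<close>; the bound is Cauchy-Schwarz.\<close>

lemma positive_op_id_diff_scaleR:
  assumes B: "positive_op B" "0 < M" "norm B \<le> M"
  shows "positive_op (id_blinfun - (1 / M) *\<^sub>R B)"
proof (rule positive_opI)
  show "complex_linear_op (id_blinfun - (1 / M) *\<^sub>R B)"
    using B by (intro complex_linear_op_diff complex_linear_op_id complex_linear_op_scaleR positive_op_linear)
  show "inner x ((id_blinfun - (1 / M) *\<^sub>R B) y) = inner ((id_blinfun - (1 / M) *\<^sub>R B) x) y" for x y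
    by (simp add: blinfun.bilinear_simps inner_diff_left inner_diff_right positive_op_symmetric[OF B(1)])
  show "0 \<le> inner x ((id_blinfun - (1 / M) *\<^sub>R B) x)" for x
  proof -
    have "inner x (B x) \<le> norm x * norm (B x)"
      by (rule norm_cauchy_schwarz)
    also have "\<dots> \<le> norm x * (norm B * norm x)"
      by (intro mult_left_mono norm_blinfun) simp
    also have "\<dots> \<le> norm x * (M * norm x)"
      using B by (intro mult_left_mono mult_right_mono) auto
    finally have "inner x (B x) \<le> M * inner x x"
      by (simp add: dot_square_norm power2_eq_square mult_ac)
    then show ?thesis
      using B by (simp add: blinfun.bilinear_simps inner_diff_right field_simps)
  qed
qed

lemma op_invertible_add_scaleR_id:
  assumes B: "positive_op B" and e: "0 < e"
  shows "op_invertible (B + e *\<^sub>R id_blinfun)"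
proof -
  \<comment> \<open>The summand 1 keeps M positive for B = 0.\<close>
  define M where "M = norm B + 1"
  have M: "0 < M" "norm B \<le> M"
    by (auto simp: M_def add_nonneg_pos)
  define A where "A = (1 / M) *\<^sub>R B"
  have A: "positive_op A" "positive_op (id_blinfun - A)"
    using M B by (auto simp: A_def intro!: positive_op_scaleR positive_op_id_diff_scaleR)
  \<comment> \<open>The reciprocal of e + b in the rescaled variable b = M a; multiplicativity of
    the calculus makes its value the inverse.\<close>
  define g where "g a = 1 / (e + M * a)" for a
  have den: "e + M * a \<noteq> 0" if "a \<in> {0..1}" for a
    using that M e by (metis add_pos_nonneg atLeastAtMost_iff less_irrefl mult_nonneg_nonneg less_imp_le)
  have g: "continuous_on {0..1} g"
    unfolding g_def using den by (intro continuous_intros) auto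
  obtain G where G: "calculus A g G"
    using calculus_exists[OF A g] .
  have p: "poly_op [:e, M:] A = B + e *\<^sub>R id_blinfun"
    using M by (intro blinfun_eqI) (simp add: A_def blinfun.bilinear_simps)
  have cp: "calculus A (poly [:e, M:]) (B + e *\<^sub>R id_blinfun)"
    using calculus_poly[of A "[:e, M:]"] by (simp only: p)
  have c1: "calculus A (\<lambda>a. 1) id_blinfun"
    by (rule calculus_cong[of A "poly [:1:]"]) (use calculus_poly[of A "[:1:]"] in simp_all)
  have contp: "continuous_on {0..1} (poly [:e, M:])"
    using continuous_on_poly[OF continuous_on_id, of _ "[:e, M:]"] by simp
  have "calculus A (\<lambda>a. 1) ((B + e *\<^sub>R id_blinfun) o\<^sub>L G)"
    by (rule calculus_cong[OF calculus_mult[OF cp G contp g]]) (use den in \<open>simp add: g_def mult.commute\<close>)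
  moreover have "calculus A (\<lambda>a. 1) (G o\<^sub>L (B + e *\<^sub>R id_blinfun))"
    by (rule calculus_cong[OF calculus_mult[OF G cp g contp]]) (use den in \<open>simp add: g_def mult.commute\<close>)
  ultimately show ?thesis
    using calculus_unique[OF A _ c1] unfolding op_invertible_def is_op_inverse_def by metis
qed

lemma strictly_positive_op_add_scaleR_id:
  assumes "positive_op B" "0 < e"
  shows "strictly_positive_op (B + e *\<^sub>R id_blinfun)"
  using assms op_invertible_add_scaleR_id
  by (auto simp: strictly_positive_op_def intro!: positive_op_add positive_op_scaleR positive_op_id)

lemma positive_op_sqrt:
  assumes B: "positive_op B"
  obtains S where "positive_op S" "S o\<^sub>L S = B"
proof -
  define M where "M = norm B + 1"
  have M: "0 < M" "norm B \<le> M"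
    by (auto simp: M_def add_nonneg_pos)
  define A where "A = (1 / M) *\<^sub>R B"
  have A: "positive_op A" "positive_op (id_blinfun - A)"
    using M B by (auto simp: A_def intro!: positive_op_scaleR positive_op_id_diff_scaleR)
  define g where "g a = sqrt (sqrt a)" for a
  have g: "continuous_on {0..1} g"
    unfolding g_def by (intro continuous_intros)
  \<comment> \<open>The square of a fourth root rather than a square root: positivity is then immediate.\<close>
  obtain Y where Y: "calculus A g Y"
    using calculus_exists[OF A g] .
  have sq: "g a * g a * (g a * g a) = a" if "0 \<le> a" for a
    using that by (simp add: g_def)
  have "calculus A (\<lambda>a. g a * g a * (g a * g a)) ((Y o\<^sub>L Y) o\<^sub>L (Y o\<^sub>L Y))"
    by (intro calculus_mult Y g continuous_intros)
  then have "calculus A (poly [:0, 1:]) ((Y o\<^sub>L Y) o\<^sub>L (Y o\<^sub>L Y))"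
    by (rule calculus_cong) (simp add: sq)
  then have "(Y o\<^sub>L Y) o\<^sub>L (Y o\<^sub>L Y) = poly_op [:0, 1:] A"
    using calculus_unique[OF A] calculus_poly by blast
  then have YY: "Y (Y (Y (Y x))) = A x" for x
    by (metis (no_types) add_0 blinfun_apply_blinfun_compose blinfun_compose_id_right
        blinfun_compose_zero(2) add.right_neutral poly_op_0 poly_op_pCons scaleR_zero_left scaleR_one)
  \<comment> \<open>The factor undoes the scaling: Y^4 is B/M.\<close>
  define S where "S = sqrt M *\<^sub>R (Y o\<^sub>L Y)"
  have "positive_op (Y o\<^sub>L id_blinfun o\<^sub>L Y)"
    by (intro positive_op_congruence positive_op_id calculus_linear[OF A(1) Y] calculus_symmetric[OF A(1) Y])
  then have "positive_op S"
    using M by (auto simp: S_def intro!: positive_op_scaleR)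
  moreover have "S o\<^sub>L S = B"
    using M by (intro blinfun_eqI) (simp add: S_def blinfun.bilinear_simps YY A_def)
  ultimately show thesis
    by (rule that)
qed

text \<open>With C the inverse of B = S S, the operators S C and C S are a right and a left inverse
  of S, hence equal.\<close>

lemma strictly_positive_op_sqrt:
  assumes B: "strictly_positive_op B"
  obtains S R where "positive_op S" "positive_op R" "S o\<^sub>L S = B" "is_op_inverse S R"
proof -
  obtain S where S: "positive_op S" "S o\<^sub>L S = B"
    using positive_op_sqrt B unfolding strictly_positive_op_def by blast
  obtain C where "B o\<^sub>L C = id_blinfun" "C o\<^sub>L B = id_blinfun"
    using B unfolding strictly_positive_op_def op_invertible_def is_op_inverse_def by blast
  then have "is_op_inverse S (S o\<^sub>L C)"
    by (intro is_op_inverseI[of _ _ "C o\<^sub>L S"]) (simp_all add: S(2) blinfun_compose_assoc flip: blinfun_compose_assoc[of S S])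
  then show thesis
    using that S positive_op_inverse by blast
qed


section \<open>Connections\<close>

lemma connection_transformer:
  "connection \<sigma> \<Longrightarrow> positive_op A \<Longrightarrow> positive_op B \<Longrightarrow> positive_op C \<Longrightarrow>
    C o\<^sub>L \<sigma> A B o\<^sub>L C \<le>\<^sub>o \<sigma> (C o\<^sub>L A o\<^sub>L C) (C o\<^sub>L B o\<^sub>L C)"
  by (simp add: connection_def)

lemma connection_continuous:
  "connection \<sigma> \<Longrightarrow> (\<And>n. positive_op (S n)) \<Longrightarrow> (\<And>n. positive_op (T n)) \<Longrightarrow>
    positive_op A \<Longrightarrow> positive_op B \<Longrightarrow> decreases_to S A \<Longrightarrow> decreases_to T B \<Longrightarrow>
    decreases_to (\<lambda>n. \<sigma> (S n) (T n)) (\<sigma> A B)"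
  by (simp add: connection_def)

lemma connection_transpose:
  assumes "connection \<sigma>"
  shows "connection (\<lambda>A B. \<sigma> B A)"
  unfolding connection_def
  by (intro conjI allI impI) (use assms in \<open>simp_all add: connection_def\<close>)

text \<open>The reverse inequality is the transformer inequality for the inverse R, applied to the
  conjugated pair and conjugated back by S; antisymmetry concludes.\<close>

lemma connection_congruence:
  assumes \<sigma>: "connection \<sigma>" and AB: "positive_op A" "positive_op B"
    and S: "positive_op S" "is_op_inverse S R"
  shows "\<sigma> (S o\<^sub>L A o\<^sub>L S) (S o\<^sub>L B o\<^sub>L S) = S o\<^sub>L \<sigma> A B o\<^sub>L S"
proof (rule op_le_antisym)
  note R = positive_op_inverse[OF S]
  have cancel: "R o\<^sub>L (S o\<^sub>L X o\<^sub>L S) o\<^sub>L R = X" "S o\<^sub>L (R o\<^sub>L X o\<^sub>L R) o\<^sub>L S = X" for X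
    by (auto intro!: blinfun_eqI simp: is_op_inverse_apply[OF S(2)])
  have pos: "positive_op (S o\<^sub>L X o\<^sub>L S)" if "positive_op X" for X
    using that S by (intro positive_op_congruence positive_op_linear positive_op_symmetric)
  show "S o\<^sub>L \<sigma> A B o\<^sub>L S \<le>\<^sub>o \<sigma> (S o\<^sub>L A o\<^sub>L S) (S o\<^sub>L B o\<^sub>L S)"
    by (rule connection_transformer[OF \<sigma> AB S(1)])
  have "R o\<^sub>L \<sigma> (S o\<^sub>L A o\<^sub>L S) (S o\<^sub>L B o\<^sub>L S) o\<^sub>L R \<le>\<^sub>o \<sigma> A B"
    using connection_transformer[OF \<sigma> pos[OF AB(1)] pos[OF AB(2)] R] by (simp only: cancel)
  from op_le_congruence[OF this S(1)]
  show "\<sigma> (S o\<^sub>L A o\<^sub>L S) (S o\<^sub>L B o\<^sub>L S) \<le>\<^sub>o S o\<^sub>L \<sigma> A B o\<^sub>L S"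
    by (simp only: cancel)
qed

lemma decreases_to_const: "decreases_to (\<lambda>n. A) A"
  by (simp add: decreases_to_def op_le_refl)

lemma decreases_to_add_id:
  "decreases_to (\<lambda>n. A + (1 / real (Suc n)) *\<^sub>R id_blinfun) A"
  unfolding decreases_to_def
proof (intro conjI allI)
  fix n
  have "positive_op ((1 / real (Suc n) - 1 / real (Suc (Suc n))) *\<^sub>R id_blinfun :: 'a \<Rightarrow>\<^sub>L 'a)"
    by (intro positive_op_scaleR positive_op_id) (simp add: frac_le)
  then show "A + (1 / real (Suc (Suc n))) *\<^sub>R id_blinfun \<le>\<^sub>o A + (1 / real (Suc n)) *\<^sub>R id_blinfun"
    by (simp add: op_le_def scaleR_diff_left)
next
  fix x
  have "(\<lambda>n. A x + (1 / real (Suc n)) *\<^sub>R x) \<longlonglongrightarrow> A x + 0 *\<^sub>R x"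
    using LIMSEQ_inverse_real_of_nat unfolding inverse_eq_divide by (intro tendsto_add tendsto_scaleR tendsto_const)
  then show "(\<lambda>n. (A + (1 / real (Suc n)) *\<^sub>R id_blinfun) x) \<longlonglongrightarrow> A x"
    by (simp add: blinfun.bilinear_simps)
qed


section \<open>Weighted harmonic means\<close>

text \<open>The mean 1/((1 - t) + t/x), expanded by x so that x = 0 is covered for t > 0. At t = 0
  and x = 0 the quotient would be 0/0, which is 0 in HOL, whereas 1 !_0 0 is 1; hence the separate
  case.\<close>

definition harmonic_fun :: "real \<Rightarrow> real \<Rightarrow> real"
  where "harmonic_fun t x = (if t = 0 then 1 else x / ((1 - t) * x + t))"

lemma harmonic_denominator_pos:
  fixes t x :: real
  assumes "0 < t" "t \<le> 1" "0 \<le> x"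
  shows "0 < (1 - t) * x + t"
  using assms by (simp add: add_nonneg_pos)

lemma continuous_on_harmonic_fun:
  assumes "0 \<le> t" "t \<le> 1"
  shows "continuous_on {0..} (harmonic_fun t)"
proof (cases "t = 0")
  case False
  then have "(1 - t) * x + t \<noteq> 0" if "0 \<le> x" for x
    using harmonic_denominator_pos[of t x] that assms by simp
  then have "continuous_on {0..} (\<lambda>x. x / ((1 - t) * x + t))"
    by (intro continuous_intros) auto
  then show ?thesis
    by (rule continuous_on_eq) (simp add: harmonic_fun_def False)
qed (simp add: harmonic_fun_def[abs_def])

text \<open>A weighted harmonic mean does not exceed the larger argument. The bound is free of t, so
  it is a constant majorant for dominated convergence.\<close>

lemma harmonic_fun_bounds:
  assumes "0 \<le> t" "t \<le> 1" "0 \<le> x"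
  shows "0 \<le> harmonic_fun t x" "harmonic_fun t x \<le> max 1 x"
proof -
  have "x \<le> ((1 - t) * x + t) * max 1 x"
  proof (cases "x \<le> 1")
    case True
    then have "0 \<le> t * (1 - x)" using assms by simp
    then show ?thesis using True by (simp add: algebra_simps)
  next
    case False
    then have "0 \<le> (1 - t) * (x * (x - 1))" using assms by simp
    then show ?thesis using False by (simp add: algebra_simps max_def)
  qed
  then show "harmonic_fun t x \<le> max 1 x" "0 \<le> harmonic_fun t x"
    using assms harmonic_denominator_pos[of t x]
    by (auto simp: harmonic_fun_def pos_divide_le_eq mult.commute)
qed

text \<open>Cross-multiplication cancels the terms (1 - t) x y and leaves t x < t y.\<close>

lemma harmonic_fun_strict_mono:
  assumes "0 < t" "t \<le> 1" "0 \<le> x" "x < y"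
  shows "harmonic_fun t x < harmonic_fun t y"
proof -
  have pos: "0 < (1 - t) * x + t" "0 < (1 - t) * y + t"
    using assms by (auto intro: harmonic_denominator_pos)
  have "t * x < t * y"
    using assms by simp
  then have "x * ((1 - t) * y + t) < y * ((1 - t) * x + t)"
    by (simp add: algebra_simps)
  then have "x < y / ((1 - t) * y + t) * ((1 - t) * x + t)"
    using pos by (simp add: pos_less_divide_eq)
  then show ?thesis
    using pos assms by (simp add: harmonic_fun_def pos_divide_less_eq)
qed

text \<open>For t > 0 the mean factors as B D^(-1) with D = (1 - t) B + t I, and the calculus value
  G satisfies G D = B by multiplicativity, since the denominator of \<open>harmonic_fun\<close> is a
  polynomial.\<close>

lemma calculus_harmonic_fun:
  assumes B: "strictly_positive_op B" and M: "0 < M" "norm B \<le> M" and t: "0 \<le> t" "t \<le> 1"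
  shows "calculus ((1 / M) *\<^sub>R B) (\<lambda>a. harmonic_fun t (M * a)) (weighted_harmonic_mean t id_blinfun B)"
proof (cases "t = 0")
  case True
  have "weighted_harmonic_mean t id_blinfun B = id_blinfun"
    using B by (simp add: weighted_harmonic_mean_def strictly_positive_op_id True)
  moreover have "calculus ((1 / M) *\<^sub>R B) (poly [:1:]) (id_blinfun)"
    using calculus_poly[of "(1 / M) *\<^sub>R B" "[:1:]"] by simp
  ultimately show ?thesis
    by (simp add: harmonic_fun_def True calculus_cong[of _ "poly [:1:]"])
next
  case False
  then have t0: "0 < t" using t by simp
  define A where "A = (1 / M) *\<^sub>R B"
  define g where "g a = harmonic_fun t (M * a)" for a
  \<comment> \<open>From (1 - t) I + t B^(-1) = D B^(-1).\<close>
  define D where "D = (1 - t) *\<^sub>R B + t *\<^sub>R id_blinfun"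
  have Bpos: "positive_op B" and B': "is_op_inverse B (op_inverse B)"
    using B by (auto simp: strictly_positive_op_def op_inverse_works)
  have A: "positive_op A" "positive_op (id_blinfun - A)"
    using M Bpos by (auto simp: A_def intro!: positive_op_scaleR positive_op_id_diff_scaleR)
  have "op_invertible D"
    unfolding D_def using Bpos t t0
    by (intro op_invertible_add_scaleR_id positive_op_scaleR) auto
  then have D': "is_op_inverse D (op_inverse D)"
    by (rule op_inverse_works)
  have "(1 - t) *\<^sub>R id_blinfun + t *\<^sub>R op_inverse B = D o\<^sub>L op_inverse B"
    by (intro blinfun_eqI) (simp add: D_def blinfun.bilinear_simps is_op_inverse_apply[OF B'])
  then have "op_inverse ((1 - t) *\<^sub>R id_blinfun + t *\<^sub>R op_inverse B) = B o\<^sub>L op_inverse D"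
    using is_op_inverse_compose[OF D' is_op_inverse_sym[OF B']] by (simp add: op_inverse_eq)
  then have H: "weighted_harmonic_mean t id_blinfun B = B o\<^sub>L op_inverse D"
    using B by (simp add: weighted_harmonic_mean_def strictly_positive_op_id)
  have g: "continuous_on {0..1} g"
    unfolding g_def
    by (rule continuous_on_compose2[OF continuous_on_harmonic_fun[OF t]])
      (use M in \<open>auto intro!: continuous_intros\<close>)
  obtain G where G: "calculus A g G"
    using calculus_exists[OF A g] .
  have p: "poly_op [:t, (1 - t) * M:] A = D" "poly_op [:0, M:] A = B"
    using M by (intro blinfun_eqI; simp add: A_def D_def blinfun.bilinear_simps)+
  have "calculus A (\<lambda>a. g a * poly [:t, (1 - t) * M:] a) (G o\<^sub>L D)"
    using calculus_poly[of A "[:t, (1 - t) * M:]"] unfolding p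
    by (intro calculus_mult G g continuous_intros)
  then have "calculus A (poly [:0, M:]) (G o\<^sub>L D)"
  proof (rule calculus_cong)
    fix a :: real assume "0 \<le> a" "a \<le> 1"
    then have "0 < (1 - t) * (M * a) + t"
      using M t t0 by (intro harmonic_denominator_pos) auto
    then show "g a * poly [:t, (1 - t) * M:] a = poly [:0, M:] a"
      by (simp add: g_def harmonic_fun_def False field_simps)
  qed
  then have "G o\<^sub>L D = B"
    using calculus_unique[OF A _ calculus_poly[of A "[:0, M:]"]] by (simp only: p)
  then have "G = B o\<^sub>L op_inverse D"
    by (metis D' blinfun_compose_assoc blinfun_compose_id_right is_op_inverse_def)
  with G show ?thesis
    unfolding H A_def g_def by simp
qed

lemma weighted_harmonic_mean_commute:
  assumes "strictly_positive_op A" "strictly_positive_op B"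
  shows "weighted_harmonic_mean t A B = weighted_harmonic_mean (1 - t) B A"
  using assms by (simp add: weighted_harmonic_mean_def add.commute)


section \<open>The representing function as a functional calculus\<close>

text \<open>The integral formula is posed at strictly positive arguments, where exchanging the
  arguments amounts to t \<mapsto> 1 - t; the locale is thereby stable under transposition. The real
  \<open>inner\<close> gives the real part of the weak formula.\<close>

locale represented_connection = finite_measure \<mu>
  for \<sigma> :: "'a::complex_hilbert_space op_binary" and \<mu> :: "real measure" +
  assumes connection: "connection \<sigma>"
    and sets_eq: "sets \<mu> = sets borel_unit_interval"
    and represents: "strictly_positive_op A \<Longrightarrow> strictly_positive_op B \<Longrightarrow>
      has_bochner_integral \<mu> (\<lambda>t. inner x (weighted_harmonic_mean t A B y)) (inner x (\<sigma> A B y))"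
begin

lemma space_eq: "space \<mu> = {0..1}"
  using sets_eq_imp_space_eq[OF sets_eq] by (simp add: space_restrict_space)

lemma diff_in_sets: "{0..1} - {a} \<in> sets \<mu>"
  unfolding sets_eq by (auto simp: sets_restrict_space)

definition rep_fun :: "real \<Rightarrow> real"
  where "rep_fun x = (\<integral>t. harmonic_fun t x \<partial>\<mu>)"

lemma harmonic_fun_measurable: "(\<lambda>t. harmonic_fun t x) \<in> borel_measurable \<mu>"
proof -
  have "(\<lambda>t. harmonic_fun t x) \<in> borel_measurable borel"
    unfolding harmonic_fun_def by measurable
  then show ?thesis
    using measurable_restrict_space1 measurable_cong_sets[OF sets_eq refl] by blast
qed

lemma harmonic_fun_integrable:
  assumes "0 \<le> x"
  shows "integrable \<mu> (\<lambda>t. harmonic_fun t x)"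
  using harmonic_fun_bounds[OF _ _ assms]
  by (intro integrable_const_bound[of _ "max 1 x"] harmonic_fun_measurable AE_I2)
    (auto simp: space_eq)

lemma rep_fun_continuous:
  assumes M: "0 \<le> M"
  shows "continuous_on {0..1} (\<lambda>a. rep_fun (M * a))"
proof (rule continuous_on_sequentiallyI)
  fix u :: "nat \<Rightarrow> real" and a :: real
  assume u: "\<forall>n. u n \<in> {0..1}" and a: "a \<in> {0..1}" and lim: "u \<longlonglongrightarrow> a"
  have Mu: "0 \<le> M * u n" "M * u n \<le> M" for n
    using u[rule_format, of n] M by (auto intro: mult_left_le)
  show "(\<lambda>n. rep_fun (M * u n)) \<longlonglongrightarrow> rep_fun (M * a)"
    unfolding rep_fun_def
  proof (rule integral_dominated_convergence[where w = "\<lambda>_. max 1 M"])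
    show "AE t in \<mu>. (\<lambda>n. harmonic_fun t (M * u n)) \<longlonglongrightarrow> harmonic_fun t (M * a)"
    proof (rule AE_I2)
      fix t assume "t \<in> space \<mu>"
      then have "continuous_on {0..} (harmonic_fun t)"
        by (intro continuous_on_harmonic_fun) (auto simp: space_eq)
      then show "(\<lambda>n. harmonic_fun t (M * u n)) \<longlonglongrightarrow> harmonic_fun t (M * a)"
        using Mu a M lim
        by (intro continuous_on_tendsto_compose[of "{0..}" "harmonic_fun t"] tendsto_mult_left) auto
    qed
    show "AE t in \<mu>. norm (harmonic_fun t (M * u n)) \<le> max 1 M" for n
    proof (rule AE_I2)
      fix t assume "t \<in> space \<mu>"
      then have "0 \<le> t" "t \<le> 1" by (auto simp: space_eq)
      from harmonic_fun_bounds[OF this Mu(1)[of n]] Mu(2)[of n]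
      show "norm (harmonic_fun t (M * u n)) \<le> max 1 M" by auto
    qed
  qed (auto intro: harmonic_fun_measurable)
qed

text \<open>The calculus value G and I \<sigma> B are compared between vectors x and y: both are
  limits of the matrix coefficients of the Bernstein polynomials of \<open>rep_fun\<close>, on one
  side by definition of G, on the other by integrating the Bernstein polynomials of the functions
  \<open>harmonic_fun t\<close>.\<close>

lemma calculus_rep_fun_strict:
  assumes B: "strictly_positive_op B" and M: "0 < M" "norm B \<le> M"
  shows "calculus ((1 / M) *\<^sub>R B) (\<lambda>a. rep_fun (M * a)) (\<sigma> id_blinfun B)"
proof -
  define A where "A = (1 / M) *\<^sub>R B"
  have A: "positive_op A" "positive_op (id_blinfun - A)"
    using M B by (auto simp: A_def strictly_positive_op_def intro!: positive_op_scaleR positive_op_id_diff_scaleR)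
  define g where "g a = rep_fun (M * a)" for a
  have g: "continuous_on {0..1} g"
    unfolding g_def using M by (intro rep_fun_continuous) simp
  obtain G where G: "calculus A g G"
    using calculus_exists[OF A g] .
  have lim: "(\<lambda>n. poly_op (bernstein_poly n g) A) \<longlonglongrightarrow> G"
    by (rule calculus_tendsto[OF A G uniform_limit_bernstein_poly[OF g]])
  have "inner x (G y) = inner x (\<sigma> id_blinfun B y)" for x y
  proof -
    let ?q = "\<lambda>n t. bernstein_poly n (\<lambda>a. harmonic_fun t (M * a))"
    let ?b = "\<lambda>n k. inner x (poly_op (bernstein_basis n k) A y)"
    have expand: "inner x (poly_op (bernstein_poly n k) A y) = (\<Sum>j\<le>n. k (real j / real n) * ?b n j)" for n and k :: "real \<Rightarrow> real"
      by (simp add: bernstein_poly_def poly_op_sum poly_op_smult blinfun.sum_left blinfun.scaleR_left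
          inner_sum_right)
    have int: "integrable \<mu> (\<lambda>t. harmonic_fun t (M * (k / n)))" for k n :: nat
      using M by (intro harmonic_fun_integrable) simp
    \<comment> \<open>Only finitely many nodes occur, so the integral that defines g passes through
      the sum.\<close>
    have "inner x (poly_op (bernstein_poly n g) A y) = (\<integral>t. inner x (poly_op (?q n t) A y) \<partial>\<mu>)" for n
    proof -
      have "(\<integral>t. (\<Sum>j\<le>n. harmonic_fun t (M * (real j / real n)) * ?b n j) \<partial>\<mu>)
          = (\<Sum>j\<le>n. \<integral>t. harmonic_fun t (M * (real j / real n)) * ?b n j \<partial>\<mu>)"
        by (intro Bochner_Integration.integral_sum integrable_mult_left int)
      then show ?thesis
        unfolding expand g_def rep_fun_def by (simp only: integral_mult_left_zero)
    qed
    moreover have "(\<lambda>n. \<integral>t. inner x (poly_op (?q n t) A y) \<partial>\<mu>) \<longlonglongrightarrow> inner x (\<sigma> id_blinfun B y)"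
    proof -
      have rep: "has_bochner_integral \<mu> (\<lambda>t. inner x (weighted_harmonic_mean t id_blinfun B y))
          (inner x (\<sigma> id_blinfun B y))"
        by (rule represents[OF strictly_positive_op_id B])
      have "(\<lambda>n. \<integral>t. inner x (poly_op (?q n t) A y) \<partial>\<mu>)
          \<longlonglongrightarrow> (\<integral>t. inner x (weighted_harmonic_mean t id_blinfun B y) \<partial>\<mu>)"
      proof (rule integral_dominated_convergence[where w = "\<lambda>_. norm x * (max 1 M * norm y)"])
        show "(\<lambda>t. inner x (weighted_harmonic_mean t id_blinfun B y)) \<in> borel_measurable \<mu>"
          using rep by (auto simp: has_bochner_integral_iff)
        show "(\<lambda>t. inner x (poly_op (?q n t) A y)) \<in> borel_measurable \<mu>" for n
          unfolding expand by (intro borel_measurable_sum borel_measurable_times harmonic_fun_measurable) auto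
        show "AE t in \<mu>. (\<lambda>n. inner x (poly_op (?q n t) A y)) \<longlonglongrightarrow> inner x (weighted_harmonic_mean t id_blinfun B y)"
        proof (rule AE_I2)
          fix t assume "t \<in> space \<mu>"
          then have t: "0 \<le> t" "t \<le> 1" by (auto simp: space_eq)
          have c: "continuous_on {0..1} (\<lambda>a. harmonic_fun t (M * a))"
            by (rule continuous_on_compose2[OF continuous_on_harmonic_fun[OF t]])
              (use M in \<open>auto intro!: continuous_intros\<close>)
          have "(\<lambda>n. poly_op (?q n t) A) \<longlonglongrightarrow> weighted_harmonic_mean t id_blinfun B"
            by (rule calculus_tendsto[OF A _ uniform_limit_bernstein_poly[OF c]])
              (use calculus_harmonic_fun[OF B M t] in \<open>simp add: A_def\<close>)
          then show "(\<lambda>n. inner x (poly_op (?q n t) A y)) \<longlonglongrightarrow> inner x (weighted_harmonic_mean t id_blinfun B y)"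
            by (intro tendsto_intros)
        qed
        show "AE t in \<mu>. norm (inner x (poly_op (?q n t) A y)) \<le> norm x * (max 1 M * norm y)" for n
        proof (rule AE_I2)
          fix t assume "t \<in> space \<mu>"
          then have t: "0 \<le> t" "t \<le> 1" by (auto simp: space_eq)
          \<comment> \<open>A Bernstein polynomial at a point is a convex combination of the node
            values, so the bound on \<open>harmonic_fun\<close> carries over.\<close>
          have "norm (poly_op (?q n t) A) \<le> max 1 M"
          proof (rule poly_op_norm_le[OF A])
            fix a :: real assume a: "0 \<le> a" "a \<le> 1"
            have b: "\<bar>harmonic_fun t (M * (k / n))\<bar> \<le> max 1 M" if "k \<le> n" for k
            proof -
              \<comment> \<open>This includes n = 0, where the node 0/0 is 0.\<close>
              have "real k / real n \<le> 1"
                using that by (auto simp: divide_le_eq_1)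
              then have "0 \<le> M * (k / n)" "M * (k / n) \<le> M"
                using M by (auto intro: mult_left_le simp del: times_divide_eq_right)
              with harmonic_fun_bounds[OF t this(1)] show ?thesis by auto
            qed
            have "\<bar>poly (?q n t) a\<bar> \<le> (\<Sum>k\<le>n. \<bar>harmonic_fun t (M * (k / n)) * Bernstein n k a\<bar>)"
              unfolding poly_bernstein_poly by (rule sum_abs)
            also have "\<dots> \<le> (\<Sum>k\<le>n. max 1 M * Bernstein n k a)"
              using b Bernstein_nonneg[OF a] by (intro sum_mono) (auto simp: abs_mult intro!: mult_right_mono)
            also have "\<dots> = max 1 M"
              by (simp flip: sum_distrib_left)
            finally show "\<bar>poly (?q n t) a\<bar> \<le> max 1 M" .
          qed
          then have "norm (poly_op (?q n t) A y) \<le> max 1 M * norm y"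
            using norm_blinfun[of "poly_op (?q n t) A" y] mult_right_mono[OF _ norm_ge_zero[of y]]
            by (meson order.trans)
          then have "norm x * norm (poly_op (?q n t) A y) \<le> norm x * (max 1 M * norm y)"
            by (intro mult_left_mono) auto
          then show "norm (inner x (poly_op (?q n t) A y)) \<le> norm x * (max 1 M * norm y)"
            using Cauchy_Schwarz_ineq2[of x "poly_op (?q n t) A y"] by simp
        qed
      qed simp
      then show ?thesis
        using rep by (simp add: has_bochner_integral_integral_eq)
    qed
    ultimately have "(\<lambda>n. inner x (poly_op (bernstein_poly n g) A y)) \<longlonglongrightarrow> inner x (\<sigma> id_blinfun B y)"
      by simp
    moreover have "(\<lambda>n. inner x (poly_op (bernstein_poly n g) A y)) \<longlonglongrightarrow> inner x (G y)"
      using lim by (intro tendsto_intros)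
    ultimately show ?thesis
      using LIMSEQ_unique by blast
  qed
  then have "G y = \<sigma> id_blinfun B y" for y
    by (metis inner_commute vector_eq_rdot)
  then have "G = \<sigma> id_blinfun B"
    by (intro blinfun_eqI)
  with G show ?thesis
    by (simp add: A_def g_def[abs_def])
qed

text \<open>Continuity from above reduces this to invertible operators, so the limit defining
  \<^term>\<open>weighted_harmonic_mean\<close> outside the strictly positive operators is never needed.\<close>

lemma calculus_rep_fun:
  assumes B: "positive_op B" and M: "norm B + 1 \<le> M"
  shows "calculus ((1 / M) *\<^sub>R B) (\<lambda>a. rep_fun (M * a)) (\<sigma> id_blinfun B)"
proof -
  have M0: "0 < M" "norm B \<le> M"
    using M norm_ge_zero[of B] by linarith+
  define A where "A = (1 / M) *\<^sub>R B"
  have A: "positive_op A" "positive_op (id_blinfun - A)"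
    using M0 B by (auto simp: A_def intro!: positive_op_scaleR positive_op_id_diff_scaleR)
  define g where "g a = rep_fun (M * a)" for a
  have g: "continuous_on {0..1} g"
    unfolding g_def using M0 by (intro rep_fun_continuous) simp
  obtain G where G: "calculus A g G"
    using calculus_exists[OF A g] .
  define B' where "B' n = B + (1 / real (Suc n)) *\<^sub>R id_blinfun" for n
  have B': "strictly_positive_op (B' n)" for n
    unfolding B'_def using B by (intro strictly_positive_op_add_scaleR_id) auto
  have B'_pos: "positive_op (B' n)" for n
    using B' by (simp add: strictly_positive_op_def)
  \<comment> \<open>The margin 1 in the assumption on M absorbs the perturbation, so one scaling
    serves all n.\<close>
  have B'_norm: "norm (B' n) \<le> M" for n
  proof -
    have "norm (B' n) \<le> norm B + 1 / real (Suc n) * norm (id_blinfun :: 'a \<Rightarrow>\<^sub>L 'a)"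
      unfolding B'_def by (rule order.trans[OF norm_triangle_ineq]) simp
    also have "\<dots> \<le> norm B + 1 * 1"
      by (intro add_left_mono mult_mono norm_blinfun_id_le) auto
    finally show ?thesis using M by simp
  qed
  have B'_lim: "decreases_to B' B"
    using decreases_to_add_id[of B] by (simp add: B'_def[abs_def])
  have K: "(\<lambda>n. \<sigma> id_blinfun (B' n) x) \<longlonglongrightarrow> \<sigma> id_blinfun B x" for x
    using connection_continuous[OF connection positive_op_id B'_pos positive_op_id B decreases_to_const B'_lim]
    by (simp add: decreases_to_def)
  define A' where "A' n = (1 / M) *\<^sub>R B' n" for n
  have A': "positive_op (A' n)" "positive_op (id_blinfun - A' n)" for n
    using M0 B'_pos B'_norm by (auto simp: A'_def intro!: positive_op_scaleR positive_op_id_diff_scaleR)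
  have "(\<lambda>n. (1 / M) *\<^sub>R (B + (1 / real (Suc n)) *\<^sub>R id_blinfun)) \<longlonglongrightarrow> (1 / M) *\<^sub>R (B + 0 *\<^sub>R id_blinfun)"
    using LIMSEQ_inverse_real_of_nat unfolding inverse_eq_divide
    by (intro tendsto_add tendsto_scaleR tendsto_const)
  then have A'_lim: "A' \<longlonglongrightarrow> A"
    by (simp add: A'_def[abs_def] B'_def A_def)
  have "G x = \<sigma> id_blinfun B x" for x
  proof -
    have "norm (G x - \<sigma> id_blinfun B x) \<le> 0 + e" if e: "e > 0" for e
    proof -
      \<comment> \<open>Two errors of size d times the norm of x will add up; the summand 1 avoids
        division by 0.\<close>
      define d where "d = e / (2 * (norm x + 1))"
      have d: "0 < d"
        using e by (simp add: d_def add_nonneg_pos)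
      obtain n where n: "\<forall>a\<in>{0..1}. dist (poly (bernstein_poly n g) a) (g a) < d"
        using uniform_limitD[OF uniform_limit_bernstein_poly[OF g] d] eventually_happens by fastforce
      define p where "p = bernstein_poly n g"
      have p: "\<bar>poly p a - g a\<bar> \<le> d" if "0 \<le> a" "a \<le> 1" for a
        using n[rule_format, of a] that by (simp add: dist_real_def p_def)
      \<comment> \<open>The polynomial is fixed before m, with an error uniform in m. As m grows,
        p(A' m) converges in norm but the connection only strongly, so the comparison is made at the
        vector x.\<close>
      have close: "norm (poly_op p (A' m) x - \<sigma> id_blinfun (B' m) x) \<le> d * norm x" for m
      proof -
        have "calculus (A' m) g (\<sigma> id_blinfun (B' m))"
          using calculus_rep_fun_strict[OF B' M0(1) B'_norm] by (simp add: A'_def g_def[abs_def])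
        then have "norm (poly_op p (A' m) - \<sigma> id_blinfun (B' m)) \<le> d"
          by (rule calculus_norm_le[OF A' _ p])
        then have "norm ((poly_op p (A' m) - \<sigma> id_blinfun (B' m)) x) \<le> d * norm x"
          by (rule order.trans[OF norm_blinfun mult_right_mono]) simp
        then show ?thesis by (simp add: blinfun.diff_left)
      qed
      have "(\<lambda>m. norm (poly_op p (A' m) x - \<sigma> id_blinfun (B' m) x)) \<longlonglongrightarrow> norm (poly_op p A x - \<sigma> id_blinfun B x)"
        by (intro tendsto_norm tendsto_diff K blinfun.tendsto poly_op_continuous A'_lim tendsto_const)
      then have 1: "norm (poly_op p A x - \<sigma> id_blinfun B x) \<le> d * norm x"
        using close by (intro LIMSEQ_le_const2) auto
      have "norm (poly_op p A - G) \<le> d"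
        by (rule calculus_norm_le[OF A G p])
      then have "norm ((poly_op p A - G) x) \<le> d * norm x"
        by (rule order.trans[OF norm_blinfun mult_right_mono]) simp
      then have 2: "norm (poly_op p A x - G x) \<le> d * norm x"
        by (simp add: blinfun.diff_left)
      have "norm (G x - \<sigma> id_blinfun B x) \<le> norm (poly_op p A x - \<sigma> id_blinfun B x) + norm (poly_op p A x - G x)"
        using norm_triangle_ineq4[of "poly_op p A x - \<sigma> id_blinfun B x" "poly_op p A x - G x"] by simp
      also have "\<dots> \<le> 2 * d * norm x"
        using 1 2 by simp
      also have "\<dots> \<le> 2 * d * (norm x + 1)"
        using d by simp
      also have "\<dots> = e"
        using norm_ge_zero[of x] unfolding d_def by (simp add: field_simps add_nonneg_eq_0_iff)
      finally show ?thesis by simp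
    qed
    then have "norm (G x - \<sigma> id_blinfun B x) \<le> 0"
      by (rule field_le_epsilon)
    then show ?thesis by simp
  qed
  then have "G = \<sigma> id_blinfun B"
    by (intro blinfun_eqI)
  with G show ?thesis
    by (simp add: A_def g_def[abs_def])
qed

end


section \<open>Left cancellability\<close>

lemma poly_op_scalar: "poly_op p (c *\<^sub>R id_blinfun) = poly p c *\<^sub>R id_blinfun"
proof (induction p)
  case (pCons a p)
  show ?case
    unfolding poly_op_pCons pCons(2)
    by (simp add: blinfun_compose_scaleR_left scaleR_add_left)
qed simp

lemma calculus_scalar:
  assumes "calculus (c *\<^sub>R id_blinfun) g G" "0 \<le> c" "c \<le> 1"
  shows "G = g c *\<^sub>R id_blinfun"
proof -
  obtain q where q: "uniform_limit {0..1} (\<lambda>n. poly (q n)) g sequentially"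
    "(\<lambda>n. poly_op (q n) (c *\<^sub>R id_blinfun)) \<longlonglongrightarrow> G"
    using assms(1) by (auto simp: calculus_def)
  have "(\<lambda>n. poly (q n) c *\<^sub>R (id_blinfun :: 'a \<Rightarrow>\<^sub>L 'a)) \<longlonglongrightarrow> g c *\<^sub>R id_blinfun"
    using tendsto_uniform_limitI[OF q(1), of c] assms(2,3) by (intro tendsto_intros) simp
  with q(2) show ?thesis
    unfolding poly_op_scalar by (rule LIMSEQ_unique)
qed

text \<open>By Stone--Weierstrass, the polynomials in an injective function are dense, so an operator
  can be recovered from its image under that function.\<close>

lemma calculus_inj_unique:
  assumes A: "positive_op A" "positive_op (id_blinfun - A)"
    and B: "positive_op B" "positive_op (id_blinfun - B)"
    and g: "continuous_on {0..1} g" "inj_on g {0..1}"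
    and G: "calculus A g G" "calculus B g G"
  shows "A = B"
proof -
  \<comment> \<open>The polynomials in g form an algebra of continuous functions; injectivity of g
    is separation of points.\<close>
  interpret function_ring_on "range (\<lambda>p x. poly p (g x))" "{0..1}"
  proof
    show "compact {0..1 :: real}"
      by (rule compact_Icc)
    show "continuous_on {0..1} f" if "f \<in> range (\<lambda>p x. poly p (g x))" for f
      using that g by (auto intro!: continuous_intros)
    show "(\<lambda>x. f x + h x) \<in> range (\<lambda>p x. poly p (g x))"
      if fh: "f \<in> range (\<lambda>p x. poly p (g x))" "h \<in> range (\<lambda>p x. poly p (g x))" for f h
    proof -
      obtain p q where "f = (\<lambda>x. poly p (g x))" "h = (\<lambda>x. poly q (g x))"
        using fh by blast
      then show ?thesis by (intro range_eqI[of _ _ "p + q"]) simp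
    qed
    show "(\<lambda>x. f x * h x) \<in> range (\<lambda>p x. poly p (g x))"
      if fh: "f \<in> range (\<lambda>p x. poly p (g x))" "h \<in> range (\<lambda>p x. poly p (g x))" for f h
    proof -
      obtain p q where "f = (\<lambda>x. poly p (g x))" "h = (\<lambda>x. poly q (g x))"
        using fh by blast
      then show ?thesis by (intro range_eqI[of _ _ "p * q"]) simp
    qed
    show "(\<lambda>_. c) \<in> range (\<lambda>p x. poly p (g x))" for c
      by (intro range_eqI[of _ _ "[:c:]"]) simp
    show "\<exists>f\<in>range (\<lambda>p x. poly p (g x)). f x \<noteq> f y" if "x \<in> {0..1}" "y \<in> {0..1}" "x \<noteq> y" for x y
    proof (rule bexI)
      show "g x \<noteq> g y"
        using that inj_onD[OF g(2)] by blast
      show "g \<in> range (\<lambda>p x. poly p (g x))"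
        by (intro range_eqI[of _ _ "[:0, 1:]"]) simp
    qed
  qed
  have "norm (A - B) \<le> 0 + e" if "e > 0" for e
  proof -
    from that have "e / 2 > 0" by simp
    from Stone_Weierstrass_basic[OF continuous_on_id this]
    obtain h where "h \<in> range (\<lambda>p x. poly p (g x))" and h: "\<forall>x\<in>{0..1}. \<bar>x - h x\<bar> < e / 2"
      by blast
    then obtain p where "h = (\<lambda>x. poly p (g x))"
      by blast
    with h have p: "\<bar>a - poly p (g a)\<bar> < e / 2" if "0 \<le> a" "a \<le> 1" for a
      using that by simp
    \<comment> \<open>Since p o g approximates the identity function, p(G) approximates every
      contraction whose image under g is G, in particular both A and B.\<close>
    have bound: "norm (C - poly_op p G) \<le> e / 2"
      if C: "positive_op C" "positive_op (id_blinfun - C)" "calculus C g G" for C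
    proof -
      have "norm (poly_op [:0, 1:] C - poly_op p G) \<le> e / 2"
        by (rule calculus_norm_le[OF C(1,2) calculus_poly_compose[OF C(3) g(1)]])
          (use p in \<open>auto intro: less_imp_le\<close>)
      then show ?thesis by simp
    qed
    have "norm (A - B) \<le> norm (A - poly_op p G) + norm (B - poly_op p G)"
      using norm_triangle_ineq4[of "A - poly_op p G" "B - poly_op p G"] by simp
    then show ?thesis
      using bound[OF A G(1)] bound[OF B G(2)] by simp
  qed
  then have "norm (A - B) \<le> 0"
    by (rule field_le_epsilon)
  then show ?thesis by simp
qed

section \<open>Criteria for left cancellability in terms of the measure\<close>

context represented_connection
begin

text \<open>If the integrals agreed, their nonnegative difference would vanish almost everywhere; it
  is positive for t > 0, so \<open>{0..1} - {0}\<close> would be a null set.\<close>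

lemma rep_fun_strict_mono:
  assumes m: "measure \<mu> ({0..1} - {0}) \<noteq> 0" and xy: "0 \<le> x" "x < y"
  shows "rep_fun x < rep_fun y"
proof -
  have int: "integrable \<mu> (\<lambda>t. harmonic_fun t y - harmonic_fun t x)"
    using xy by (intro Bochner_Integration.integrable_diff harmonic_fun_integrable) auto
  have diff: "rep_fun y - rep_fun x = (\<integral>t. harmonic_fun t y - harmonic_fun t x \<partial>\<mu>)"
    unfolding rep_fun_def using xy
    by (intro Bochner_Integration.integral_diff[symmetric] harmonic_fun_integrable) auto
  have le: "0 \<le> harmonic_fun t y - harmonic_fun t x" if "t \<in> space \<mu>" for t
    using that xy harmonic_fun_strict_mono[of t x y]
    by (cases "t = 0") (auto simp: space_eq harmonic_fun_def[of 0])
  then have nonneg: "AE t in \<mu>. 0 \<le> harmonic_fun t y - harmonic_fun t x"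
    by (rule AE_I2)
  have "0 \<le> rep_fun y - rep_fun x"
    unfolding diff using nonneg by (rule integral_nonneg_AE)
  moreover have "rep_fun y - rep_fun x \<noteq> 0"
  proof
    assume "rep_fun y - rep_fun x = 0"
    then have "AE t in \<mu>. harmonic_fun t y - harmonic_fun t x = 0"
      unfolding diff using integral_nonneg_eq_0_iff_AE[OF int nonneg] by blast
    then have "AE t in \<mu>. t \<notin> {0..1} - {0}"
    proof (rule AE_mp)
      show "AE t in \<mu>. harmonic_fun t y - harmonic_fun t x = 0 \<longrightarrow> t \<notin> {0..1} - {0}"
      proof (intro AE_I2 impI notI)
        fix t assume "harmonic_fun t y - harmonic_fun t x = 0" "t \<in> {0..1} - {0}"
        then show False
          using xy harmonic_fun_strict_mono[of t x y] by simp
      qed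
    qed
    then have "emeasure \<mu> ({0..1} - {0}) = 0"
      using AE_iff_null_sets[OF diff_in_sets[of 0]] by blast
    with m show False
      by (simp add: measure_def)
  qed
  ultimately show ?thesis by linarith
qed

lemma AE_eq_point:
  assumes "measure \<mu> ({0..1} - {a}) = 0"
  shows "AE t in \<mu>. t = a"
proof (rule AE_I)
  show "emeasure \<mu> ({0..1} - {a}) = 0"
    using assms by (simp add: emeasure_eq_measure)
  show "{t \<in> space \<mu>. t \<noteq> a} \<subseteq> {0..1} - {a}"
    unfolding space_eq by blast
  show "{0..1} - {a} \<in> sets \<mu>"
    by (rule diff_in_sets)
qed

lemma rep_fun_point:
  assumes "measure \<mu> ({0..1} - {a}) = 0" "a = 0 \<or> a = 1"
  shows "rep_fun x = measure \<mu> {0..1} * harmonic_fun a x"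
proof -
  have "rep_fun x = (\<integral>t. harmonic_fun a x \<partial>\<mu>)"
    unfolding rep_fun_def using AE_eq_point[OF assms(1)]
    by (intro integral_cong_AE harmonic_fun_measurable) auto
  then show ?thesis by (simp add: space_eq)
qed

text \<open>If almost every t equals a, each measurable set agrees almost everywhere with the whole
  space or the empty set, according to whether it contains a; the scalar is the total mass.\<close>

lemma scalar_multiple_of_dirac_iff:
  assumes "a \<in> {0..1}"
  shows "scalar_multiple_of_dirac \<mu> a \<longleftrightarrow> measure \<mu> ({0..1} - {a}) = 0"
proof
  assume "scalar_multiple_of_dirac \<mu> a"
  then obtain c where c: "\<mu> = scale_measure (ennreal c) (return borel_unit_interval a)"
    by (auto simp: scalar_multiple_of_dirac_def)
  have "emeasure \<mu> ({0..1} - {a}) = ennreal c * emeasure (return borel_unit_interval a) ({0..1} - {a})"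
    by (subst c) simp
  also have "\<dots> = 0"
    using diff_in_sets[of a] by (simp add: sets_eq)
  finally show "measure \<mu> ({0..1} - {a}) = 0"
    by (simp add: measure_def)
next
  assume "measure \<mu> ({0..1} - {a}) = 0"
  then have ae: "AE t in \<mu>. t = a"
    by (rule AE_eq_point)
  have "\<mu> = scale_measure (ennreal (measure \<mu> {0..1})) (return borel_unit_interval a)"
  proof (rule measure_eqI)
    fix X assume X: "X \<in> sets \<mu>"
    have "emeasure \<mu> X = emeasure \<mu> (if a \<in> X then space \<mu> else {})"
      using ae X by (intro emeasure_eq_AE) auto
    then show "emeasure \<mu> X = emeasure (scale_measure (ennreal (measure \<mu> {0..1})) (return borel_unit_interval a)) X"
      using X by (auto simp: sets_eq emeasure_eq_measure space_eq)
  qed (simp add: sets_eq)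
  then show "scalar_multiple_of_dirac \<mu> a"
    unfolding scalar_multiple_of_dirac_def by (intro exI[of _ "measure \<mu> {0..1}"]) simp
qed

text \<open>Scaling with M = x turns the operator into the identity, where the calculus is
  evaluation at the point 1.\<close>

lemma connection_scalar:
  assumes "0 < x"
  shows "\<sigma> id_blinfun (x *\<^sub>R id_blinfun) = rep_fun x *\<^sub>R id_blinfun"
proof -
  have "strictly_positive_op (x *\<^sub>R id_blinfun :: 'a \<Rightarrow>\<^sub>L 'a)"
    using strictly_positive_op_add_scaleR_id[OF positive_op_zero assms] by simp
  moreover have "norm (x *\<^sub>R id_blinfun :: 'a \<Rightarrow>\<^sub>L 'a) \<le> x"
    using assms mult_left_mono[OF norm_blinfun_id_le, of x] by simp
  ultimately have "calculus ((1 / x) *\<^sub>R x *\<^sub>R id_blinfun) (\<lambda>a. rep_fun (x * a))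
      (\<sigma> id_blinfun (x *\<^sub>R id_blinfun))"
    using assms by (intro calculus_rep_fun_strict)
  then have "calculus (1 *\<^sub>R id_blinfun) (\<lambda>a. rep_fun (x * a)) (\<sigma> id_blinfun (x *\<^sub>R id_blinfun))"
    using assms by simp
  from calculus_scalar[OF this] show ?thesis by simp
qed

lemma id_left_cancel:
  assumes m: "measure \<mu> ({0..1} - {0}) \<noteq> 0"
    and BC: "positive_op B" "positive_op C" and eq: "\<sigma> id_blinfun B = \<sigma> id_blinfun C"
  shows "B = C"
proof -
  \<comment> \<open>One bound for both operators, so that the same function of the rescaled variable
    produces both sides of the equation.\<close>
  define M where "M = norm B + norm C + 1"
  have M: "0 < M" "norm B + 1 \<le> M" "norm C + 1 \<le> M" "norm B \<le> M" "norm C \<le> M"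
    using norm_ge_zero[of B] norm_ge_zero[of C] unfolding M_def by linarith+
  have "inj_on (\<lambda>a. rep_fun (M * a)) {0..1}"
  proof (rule linorder_inj_onI)
    fix a b :: real assume "a < b" "a \<in> {0..1}" "b \<in> {0..1}"
    then have "0 \<le> M * a" "M * a < M * b"
      using M(1) by simp_all
    from rep_fun_strict_mono[OF m this] show "rep_fun (M * a) \<noteq> rep_fun (M * b)"
      by simp
  qed auto
  moreover have "continuous_on {0..1} (\<lambda>a. rep_fun (M * a))"
    using M by (intro rep_fun_continuous) simp
  moreover note calculus_rep_fun[OF BC(1) M(2)] calculus_rep_fun[OF BC(2) M(3), folded eq]
  moreover have "positive_op ((1 / M) *\<^sub>R D)" "positive_op (id_blinfun - (1 / M) *\<^sub>R D)"
    if "positive_op D" "norm D \<le> M" for D :: "'a \<Rightarrow>\<^sub>L 'a"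
    using that M by (auto intro: positive_op_scaleR positive_op_id_diff_scaleR)
  ultimately have "(1 / M) *\<^sub>R B = (1 / M) *\<^sub>R C"
    using BC M(4,5) by (intro calculus_inj_unique)
  then show ?thesis using M by simp
qed

text \<open>Writes the pair (A, B) as the conjugate by S of (I, R B R).\<close>

lemma connection_id_congruence:
  assumes S: "positive_op S" "S o\<^sub>L S = A" "is_op_inverse S R" and B: "positive_op B"
  shows "\<sigma> A B = S o\<^sub>L \<sigma> id_blinfun (R o\<^sub>L B o\<^sub>L R) o\<^sub>L S"
proof -
  have R: "positive_op R"
    by (rule positive_op_inverse[OF S(1,3)])
  have "positive_op (R o\<^sub>L B o\<^sub>L R)"
    by (intro positive_op_congruence B positive_op_linear positive_op_symmetric R)
  moreover have "S o\<^sub>L (R o\<^sub>L B o\<^sub>L R) o\<^sub>L S = B"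
    by (intro blinfun_eqI) (simp add: is_op_inverse_apply[OF S(3)])
  ultimately show ?thesis
    using connection_congruence[OF connection positive_op_id _ S(1,3), of "R o\<^sub>L B o\<^sub>L R"]
    by (simp only: S(2) blinfun_compose_id_right)
qed

lemma left_cancellable_if:
  assumes m: "measure \<mu> ({0..1} - {0}) \<noteq> 0"
  shows "left_cancellable \<sigma>"
  unfolding left_cancellable_def
proof (intro allI impI)
  fix A B C :: "'a \<Rightarrow>\<^sub>L 'a"
  assume asm: "strictly_positive_op A \<and> positive_op B \<and> positive_op C \<and> \<sigma> A B = \<sigma> A C"
  then obtain S R where SR: "positive_op S" "positive_op R" "S o\<^sub>L S = A" "is_op_inverse S R"
    using strictly_positive_op_sqrt by blast
  note inv = is_op_inverse_apply[OF SR(4)]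
  have *: "S o\<^sub>L \<sigma> id_blinfun (R o\<^sub>L B o\<^sub>L R) o\<^sub>L S = S o\<^sub>L \<sigma> id_blinfun (R o\<^sub>L C o\<^sub>L R) o\<^sub>L S"
    using asm connection_id_congruence[OF SR(1,3,4)] by metis
  have cancel: "R o\<^sub>L (S o\<^sub>L X o\<^sub>L S) o\<^sub>L R = X" "S o\<^sub>L (R o\<^sub>L X o\<^sub>L R) o\<^sub>L S = X" for X
    by (auto intro!: blinfun_eqI simp: inv)
  have "\<sigma> id_blinfun (R o\<^sub>L B o\<^sub>L R) = R o\<^sub>L (S o\<^sub>L \<sigma> id_blinfun (R o\<^sub>L B o\<^sub>L R) o\<^sub>L S) o\<^sub>L R"
    by (rule cancel(1)[symmetric])
  also have "\<dots> = \<sigma> id_blinfun (R o\<^sub>L C o\<^sub>L R)"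
    unfolding * by (rule cancel(1))
  finally have "\<sigma> id_blinfun (R o\<^sub>L B o\<^sub>L R) = \<sigma> id_blinfun (R o\<^sub>L C o\<^sub>L R)" .
  moreover have "positive_op (R o\<^sub>L X o\<^sub>L R)" if "positive_op X" for X
    by (intro positive_op_congruence that positive_op_linear positive_op_symmetric SR)
  ultimately have RBR: "R o\<^sub>L B o\<^sub>L R = R o\<^sub>L C o\<^sub>L R"
    using asm id_left_cancel[OF m] by blast
  have "B = S o\<^sub>L (R o\<^sub>L B o\<^sub>L R) o\<^sub>L S"
    by (rule cancel(2)[symmetric])
  also have "\<dots> = C"
    unfolding RBR by (rule cancel(2))
  finally show "B = C" .
qed

text \<open>Here \<open>rep_fun\<close> is constantly the total mass c, so I \<sigma> B = c I.
  Congruence extends this to strictly positive A, and continuity from above along A + I/(n + 1) to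
  positive A.\<close>

lemma left_trivial_if:
  assumes m: "measure \<mu> ({0..1} - {0}) = 0"
  shows "scalar_multiple_of \<sigma> left_trivial_mean"
  unfolding scalar_multiple_of_def equal_on_positive_def left_trivial_mean_def
proof (intro exI[of _ "measure \<mu> {0..1}"] conjI allI impI)
  let ?c = "measure \<mu> {0..1}"
  have id: "\<sigma> id_blinfun B = ?c *\<^sub>R id_blinfun" if B: "positive_op B" for B
  proof -
    let ?M = "norm B + 1" and ?A = "(1 / (norm B + 1)) *\<^sub>R B"
    have M: "0 < ?M"
      by (simp add: add_nonneg_pos)
    have "calculus ?A (\<lambda>a. rep_fun (?M * a)) (\<sigma> id_blinfun B)"
      by (rule calculus_rep_fun[OF B]) simp
    moreover have "calculus ?A (\<lambda>a. rep_fun (?M * a)) (?c *\<^sub>R id_blinfun)"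
      by (rule calculus_cong[of _ "poly [:?c:]"])
        (use calculus_poly[of ?A "[:?c:]"] in \<open>simp_all add: rep_fun_point[OF m] harmonic_fun_def[of 0]\<close>)
    ultimately show ?thesis
      using B M by (intro calculus_unique[of ?A] positive_op_scaleR positive_op_id_diff_scaleR) auto
  qed
  have strict: "\<sigma> A B = ?c *\<^sub>R A" if A: "strictly_positive_op A" and B: "positive_op B" for A B
  proof -
    obtain S R where SR: "positive_op S" "positive_op R" "S o\<^sub>L S = A" "is_op_inverse S R"
      using strictly_positive_op_sqrt A by blast
    have "positive_op (R o\<^sub>L B o\<^sub>L R)"
      by (intro positive_op_congruence B positive_op_linear positive_op_symmetric SR)
    then show ?thesis
      unfolding connection_id_congruence[OF SR(1,3,4) B]
      by (simp add: id blinfun_compose_scaleR_left blinfun_compose_scaleR_right SR(3))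
  qed
  fix A B :: "'a \<Rightarrow>\<^sub>L 'a" assume "positive_op A \<and> positive_op B"
  then have A: "positive_op A" and B: "positive_op B" by auto
  let ?A = "\<lambda>n. A + (1 / real (Suc n)) *\<^sub>R id_blinfun"
  have A': "strictly_positive_op (?A n)" for n
    using A by (intro strictly_positive_op_add_scaleR_id) auto
  have "decreases_to (\<lambda>n. \<sigma> (?A n) B) (\<sigma> A B)"
    using A' A B by (intro connection_continuous[OF connection] decreases_to_const decreases_to_add_id)
      (auto simp: strictly_positive_op_def)
  then have "(\<lambda>n. ?c *\<^sub>R ?A n x) \<longlonglongrightarrow> \<sigma> A B x" for x
    unfolding strict[OF A' B] decreases_to_def by (simp only: blinfun.scaleR_left)
  moreover have "(\<lambda>n. ?c *\<^sub>R ?A n x) \<longlonglongrightarrow> ?c *\<^sub>R A x" for x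
    using decreases_to_add_id[of A] unfolding decreases_to_def by (intro tendsto_scaleR tendsto_const) blast
  ultimately have "\<sigma> A B x = ?c *\<^sub>R A x" for x
    using LIMSEQ_unique by blast
  then show "\<sigma> A B = ?c *\<^sub>R A"
    by (intro blinfun_eqI) (simp add: blinfun.scaleR_left)
qed (rule measure_nonneg)

text \<open>The identity and its double cannot be told apart by the second argument, yet they differ
  on a nonzero vector.\<close>

lemma not_left_cancellable_if:
  assumes "\<exists>x::'a. x \<noteq> 0" "scalar_multiple_of \<sigma> left_trivial_mean"
  shows "\<not> left_cancellable \<sigma>"
proof
  assume canc: "left_cancellable \<sigma>"
  have pos: "positive_op (2 *\<^sub>R id_blinfun :: 'a \<Rightarrow>\<^sub>L 'a)"
    by (intro positive_op_scaleR positive_op_id) simp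
  then have "\<sigma> id_blinfun id_blinfun = \<sigma> id_blinfun (2 *\<^sub>R id_blinfun)"
    using assms(2) positive_op_id
    unfolding scalar_multiple_of_def equal_on_positive_def left_trivial_mean_def by metis
  then have "id_blinfun = (2 *\<^sub>R id_blinfun :: 'a \<Rightarrow>\<^sub>L 'a)"
    using canc pos positive_op_id strictly_positive_op_id unfolding left_cancellable_def by blast
  then have "x = 2 *\<^sub>R x" for x :: 'a
    by (metis blinfun.scaleR_left blinfun_apply_id_blinfun id_apply)
  with assms(1) show False
    by (simp add: scaleR_2)
qed

text \<open>Three implications close a circle: positive mass off 0, cancellability, not left-trivial
  up to a scalar.\<close>

lemma left_cancellable_iff:
  assumes "\<exists>x::'a. x \<noteq> 0"
  shows "left_cancellable \<sigma> \<longleftrightarrow> measure \<mu> ({0..1} - {0}) \<noteq> 0"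
    and "left_cancellable \<sigma> \<longleftrightarrow> \<not> scalar_multiple_of \<sigma> left_trivial_mean"
  using left_cancellable_if left_trivial_if not_left_cancellable_if[OF assms] by metis+

lemma inj_on_rep_fun_iff: "inj_on rep_fun {0..} \<longleftrightarrow> measure \<mu> ({0..1} - {0}) \<noteq> 0"
proof
  assume inj: "inj_on rep_fun {0..}"
  show "measure \<mu> ({0..1} - {0}) \<noteq> 0"
  proof
    assume "measure \<mu> ({0..1} - {0}) = 0"
    from rep_fun_point[OF this] have "rep_fun 0 = rep_fun 1"
      by (simp add: harmonic_fun_def)
    with inj show False
      by (auto dest: inj_onD)
  qed
next
  assume m: "measure \<mu> ({0..1} - {0}) \<noteq> 0"
  show "inj_on rep_fun {0..}"
  proof (rule linorder_inj_onI)
    fix x y :: real assume "x < y" "x \<in> {0..}"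
    then show "rep_fun x \<noteq> rep_fun y"
      using rep_fun_strict_mono[OF m, of x y] by simp
  qed auto
qed

end


section \<open>Transposition\<close>

definition reflect_measure :: "real measure \<Rightarrow> real measure"
  where "reflect_measure \<mu> = distr \<mu> borel_unit_interval (\<lambda>t. 1 - t)"

context represented_connection
begin

lemma reflect_measurable: "(\<lambda>t. 1 - t) \<in> measurable \<mu> borel_unit_interval"
proof -
  have "(\<lambda>t. 1 - t) \<in> measurable borel_unit_interval borel_unit_interval"
    by (intro measurable_restrict_space3) auto
  then show ?thesis
    using measurable_cong_sets[OF sets_eq refl] by blast
qed

lemma represented_connection_transpose:
  "represented_connection (\<lambda>A B. \<sigma> B A) (reflect_measure \<mu>)"
proof -
  interpret r: finite_measure "reflect_measure \<mu>"
    unfolding reflect_measure_def by (rule finite_measure_distr[OF reflect_measurable])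
  show ?thesis
  proof
    show "connection (\<lambda>A B. \<sigma> B A)"
      by (rule connection_transpose[OF connection])
    show "sets (reflect_measure \<mu>) = sets borel_unit_interval"
      by (simp add: reflect_measure_def)
    fix A B :: "'a \<Rightarrow>\<^sub>L 'a" and x y
    assume A: "strictly_positive_op A" and B: "strictly_positive_op B"
    let ?f = "\<lambda>t. inner x (weighted_harmonic_mean t A B y)"
    have reflected: "?f (1 - t) = inner x (weighted_harmonic_mean t B A y)" for t
      using weighted_harmonic_mean_commute[OF A B, of "1 - t"] by simp
    have rep: "has_bochner_integral \<mu> (\<lambda>t. ?f (1 - t)) (inner x (\<sigma> B A y))"
      unfolding reflected by (rule represents[OF B A])
    \<comment> \<open>Integration against the image measure asks for measurability of
      \<open>?f\<close> itself; reflecting the measurable reflected function once more returns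
      it.\<close>
    have "(\<lambda>t. ?f (1 - t)) \<in> borel_measurable \<mu>"
      using rep by (auto simp: has_bochner_integral_iff)
    then have "(\<lambda>t. ?f (1 - t)) \<in> borel_measurable borel_unit_interval"
      using measurable_cong_sets[OF sets_eq refl] by blast
    moreover have "(\<lambda>t. 1 - t) \<in> measurable borel_unit_interval borel_unit_interval"
      by (intro measurable_restrict_space3) auto
    ultimately have "(\<lambda>t. ?f (1 - (1 - t))) \<in> borel_measurable borel_unit_interval"
      by (rule measurable_compose[rotated])
    then have "?f \<in> borel_measurable borel_unit_interval"
      by simp
    then show "has_bochner_integral (reflect_measure \<mu>) ?f (inner x (\<sigma> B A y))"
      unfolding reflect_measure_def using rep
      by (simp add: has_bochner_integral_iff integrable_distr_eq[OF reflect_measurable] integral_distr[OF reflect_measurable])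
  qed
qed

lemma measure_reflect: "measure (reflect_measure \<mu>) ({0..1} - {0}) = measure \<mu> ({0..1} - {1})"
proof -
  have "{0..1} - {0} \<in> sets borel_unit_interval"
    using diff_in_sets by (simp only: sets_eq)
  then have "measure (reflect_measure \<mu>) ({0..1} - {0}) = measure \<mu> ((\<lambda>t. 1 - t) -` ({0..1} - {0}) \<inter> space \<mu>)"
    unfolding reflect_measure_def by (rule measure_distr[OF reflect_measurable])
  also have "(\<lambda>t. 1 - t) -` ({0..1} - {0}) \<inter> space \<mu> = {0..1} - {1 :: real}"
    by (auto simp: space_eq)
  finally show ?thesis .
qed

text \<open>Symmetry and homogeneity of the harmonic means under the integral: 1 !_(1-t) x = x !_t 1
  = x (1 !_t (1/x)).\<close>

lemma rep_fun_reflect: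
  assumes "0 < x"
  shows "represented_connection.rep_fun (reflect_measure \<mu>) x = x * rep_fun (1 / x)"
proof -
  interpret transpose: represented_connection "\<lambda>A B. \<sigma> B A" "reflect_measure \<mu>"
    by (rule represented_connection_transpose)
  have meas: "(\<lambda>t. harmonic_fun t x) \<in> borel_measurable borel_unit_interval"
    using transpose.harmonic_fun_measurable measurable_cong_sets[OF transpose.sets_eq refl] by blast
  have "transpose.rep_fun x = (\<integral>t. harmonic_fun (1 - t) x \<partial>\<mu>)"
    unfolding transpose.rep_fun_def unfolding reflect_measure_def
    by (rule integral_distr[OF reflect_measurable meas])
  also have "\<dots> = (\<integral>t. x * harmonic_fun t (1 / x) \<partial>\<mu>)"
  proof (rule Bochner_Integration.integral_cong[OF refl])
    fix t assume "t \<in> space \<mu>"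
    then have t: "0 \<le> t" "t \<le> 1"
      by (auto simp: space_eq)
    \<comment> \<open>The end points are separate because \<open>harmonic_fun\<close> has a special
      case at weight 0, reached on the right for t = 0 and on the left for t = 1.\<close>
    show "harmonic_fun (1 - t) x = x * harmonic_fun t (1 / x)"
    proof (cases "t = 0 \<or> t = 1")
      case False
      then have "0 < 1 - t + t * x"
        using t assms by (simp add: add_pos_nonneg)
      moreover have "(1 - t) * (1 / x) + t = (1 - t + t * x) / x"
        using assms by (simp add: field_simps)
      ultimately show ?thesis
        using False assms by (simp add: harmonic_fun_def add.commute)
    qed (use assms in \<open>auto simp: harmonic_fun_def\<close>)
  qed
  also have "\<dots> = x * rep_fun (1 / x)"
    by (simp add: rep_fun_def)
  finally show ?thesis .
qed

section \<open>The representing function, its transpose, and the criteria on the right-hand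
  side\<close>

text \<open>For x > 0 both functions are the scalar of I \<sigma> (x I), and a nonzero vector lets
  the scalars be compared; x = 0 follows because both are continuous there.\<close>

lemma representing_function_eq:
  assumes nontrivial: "\<exists>x::'a. x \<noteq> 0" and f: "representing_function \<sigma> f" and x: "0 \<le> x"
  shows "f x = rep_fun x"
proof -
  have pos: "f y = rep_fun y" if "0 < y" for y
  proof -
    have "f y *\<^sub>R id_blinfun = rep_fun y *\<^sub>R (id_blinfun :: 'a \<Rightarrow>\<^sub>L 'a)"
      using f that connection_scalar[OF that] by (simp add: representing_function_def)
    then have "f y *\<^sub>R z = rep_fun y *\<^sub>R z" for z :: 'a
      by (metis blinfun.scaleR_left blinfun_apply_id_blinfun id_apply)
    with nontrivial show ?thesis
      by (metis scaleR_right_imp_eq)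
  qed
  show ?thesis
  proof (cases "x = 0")
    case True
    have "continuous_on {0..} f"
      using f by (simp add: representing_function_def operator_monotone_def)
    then have cf: "continuous_on {0..1} f"
      by (rule continuous_on_subset) auto
    have cr: "continuous_on {0..1} rep_fun"
      using rep_fun_continuous[of 1] by simp
    let ?u = "\<lambda>n. 1 / real (Suc n)"
    have u: "?u \<longlonglongrightarrow> 0"
      using LIMSEQ_inverse_real_of_nat by (simp only: inverse_eq_divide)
    have "(\<lambda>n. f (?u n)) \<longlonglongrightarrow> f 0"
      by (rule continuous_on_tendsto_compose[OF cf u]) auto
    moreover have "(\<lambda>n. rep_fun (?u n)) \<longlonglongrightarrow> rep_fun 0"
      by (rule continuous_on_tendsto_compose[OF cr u]) auto
    moreover have "f (?u n) = rep_fun (?u n)" for n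
      by (rule pos) simp
    ultimately show ?thesis
      unfolding True using LIMSEQ_unique by simp
  qed (use pos x in simp)
qed

text \<open>At 0 the limit in \<open>transpose_fun\<close> exists because the function of the
  reflected connection is continuous there and agrees with y f(1/y) for y > 0.\<close>

lemma transpose_fun_eq:
  assumes f: "\<And>x. 0 \<le> x \<Longrightarrow> f x = rep_fun x" and x: "0 \<le> x"
  shows "transpose_fun f x = represented_connection.rep_fun (reflect_measure \<mu>) x"
proof -
  interpret transpose: represented_connection "\<lambda>A B. \<sigma> B A" "reflect_measure \<mu>"
    by (rule represented_connection_transpose)
  have pos: "y * f (1 / y) = transpose.rep_fun y" if "0 < y" for y
    using that by (simp add: rep_fun_reflect f)
  have "continuous_on {0..1} transpose.rep_fun"
    using transpose.rep_fun_continuous[of 1] by simp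
  then have "(transpose.rep_fun \<longlongrightarrow> transpose.rep_fun 0) (at 0 within {0..1})"
    by (simp add: continuous_on_def)
  then have "(transpose.rep_fun \<longlongrightarrow> transpose.rep_fun 0) (at_right 0)"
    by (simp add: at_within_Icc_at_right)
  then have "((\<lambda>y. y * f (1 / y)) \<longlongrightarrow> transpose.rep_fun 0) (at_right 0)"
    by (rule Lim_transform_eventually) (auto simp: eventually_at_right_less pos intro: eventually_mono[OF eventually_at_right_less])
  then have "Lim (at_right 0) (\<lambda>y. y * f (1 / y)) = transpose.rep_fun 0"
    by (intro tendsto_Lim) auto
  with pos x show ?thesis
    by (simp add: transpose_fun_def)
qed

lemma right_cancellable_iff:
  assumes "\<exists>x::'a. x \<noteq> 0"
  shows "right_cancellable \<sigma> \<longleftrightarrow> measure \<mu> ({0..1} - {1}) \<noteq> 0"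
    and "right_cancellable \<sigma> \<longleftrightarrow> \<not> scalar_multiple_of \<sigma> right_trivial_mean"
proof -
  interpret transpose: represented_connection "\<lambda>A B. \<sigma> B A" "reflect_measure \<mu>"
    by (rule represented_connection_transpose)
  have canc: "right_cancellable \<sigma> \<longleftrightarrow> left_cancellable (\<lambda>A B. \<sigma> B A)"
    by (simp add: right_cancellable_def left_cancellable_def)
  have "scalar_multiple_of \<sigma> right_trivial_mean \<longleftrightarrow> scalar_multiple_of (\<lambda>A B. \<sigma> B A) left_trivial_mean"
    unfolding scalar_multiple_of_def equal_on_positive_def left_trivial_mean_def right_trivial_mean_def
    by blast
  with canc transpose.left_cancellable_iff[OF assms]
  show "right_cancellable \<sigma> \<longleftrightarrow> measure \<mu> ({0..1} - {1}) \<noteq> 0"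
    and "right_cancellable \<sigma> \<longleftrightarrow> \<not> scalar_multiple_of \<sigma> right_trivial_mean"
    unfolding measure_reflect by simp_all
qed

lemma inj_on_transpose_fun_iff:
  assumes "\<And>x. 0 \<le> x \<Longrightarrow> f x = rep_fun x"
  shows "inj_on (transpose_fun f) {0..} \<longleftrightarrow> measure \<mu> ({0..1} - {1}) \<noteq> 0"
proof -
  interpret transpose: represented_connection "\<lambda>A B. \<sigma> B A" "reflect_measure \<mu>"
    by (rule represented_connection_transpose)
  have "inj_on (transpose_fun f) {0..} \<longleftrightarrow> inj_on transpose.rep_fun {0..}"
    using transpose_fun_eq[OF assms] by (intro inj_on_cong) auto
  then show ?thesis
    by (simp only: transpose.inj_on_rep_fun_iff measure_reflect)
qed

lemma rep_fun_constant_iff: "(\<exists>c. \<forall>x\<ge>0. rep_fun x = c) \<longleftrightarrow> measure \<mu> ({0..1} - {0}) = 0"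
proof
  assume "\<exists>c. \<forall>x\<ge>0. rep_fun x = c"
  then have "rep_fun 0 = rep_fun 1"
    by force
  then show "measure \<mu> ({0..1} - {0}) = 0"
    using rep_fun_strict_mono[of 0 1] by auto
next
  assume "measure \<mu> ({0..1} - {0}) = 0"
  then show "\<exists>c. \<forall>x\<ge>0. rep_fun x = c"
    by (intro exI[of _ "measure \<mu> {0..1}"]) (simp add: rep_fun_point[of 0] harmonic_fun_def)
qed

lemma rep_fun_linear_iff: "(\<exists>c\<ge>0. \<forall>x\<ge>0. rep_fun x = c * x) \<longleftrightarrow> measure \<mu> ({0..1} - {1}) = 0"
proof
  interpret transpose: represented_connection "\<lambda>A B. \<sigma> B A" "reflect_measure \<mu>"
    by (rule represented_connection_transpose)
  assume "\<exists>c\<ge>0. \<forall>x\<ge>0. rep_fun x = c * x"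
  \<comment> \<open>The transpose of c x is the constant c. The points 1 and 2 are taken because
    \<open>rep_fun_reflect\<close> speaks of positive arguments.\<close>
  then have "transpose.rep_fun 1 = transpose.rep_fun 2"
    by (auto simp: rep_fun_reflect)
  then show "measure \<mu> ({0..1} - {1}) = 0"
    using transpose.rep_fun_strict_mono[of 1 2] by (auto simp: measure_reflect)
next
  assume "measure \<mu> ({0..1} - {1}) = 0"
  then show "\<exists>c\<ge>0. \<forall>x\<ge>0. rep_fun x = c * x"
    by (intro exI[of _ "measure \<mu> {0..1}"]) (simp add: rep_fun_point[of 1] harmonic_fun_def)
qed

text \<open>Evaluation at (I, I) forces the scalar to be 1. Hence a mean that is neither trivial
  mean is no scalar multiple of one either.\<close>

lemma mean_scalar_multiple_of:
  assumes nontrivial: "\<exists>x::'a. x \<noteq> 0" and id: "\<sigma> id_blinfun id_blinfun = id_blinfun"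
    and mult: "scalar_multiple_of \<sigma> \<tau>" "\<tau> id_blinfun id_blinfun = id_blinfun"
  shows "equal_on_positive \<sigma> \<tau>"
proof -
  obtain c where c: "\<And>A B. positive_op A \<Longrightarrow> positive_op B \<Longrightarrow> \<sigma> A B = c *\<^sub>R \<tau> A B"
    using mult(1) unfolding scalar_multiple_of_def equal_on_positive_def by blast
  obtain x :: 'a where "x \<noteq> 0"
    using nontrivial by blast
  have "id_blinfun = c *\<^sub>R (id_blinfun :: 'a \<Rightarrow>\<^sub>L 'a)"
    using c[OF positive_op_id positive_op_id] id mult(2) by simp
  then have "1 *\<^sub>R x = c *\<^sub>R x"
    by (metis blinfun.scaleR_left blinfun_apply_id_blinfun id_apply scaleR_one)
  with \<open>x \<noteq> 0\<close> have "c = 1"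
    by (metis scaleR_right_imp_eq)
  with c show ?thesis
    by (simp add: equal_on_positive_def)
qed

end

lemma represented_connectionI:
  fixes \<sigma> :: "'a::complex_hilbert_space op_binary"
  assumes "connection \<sigma>" "associated_measure \<sigma> \<mu>"
  shows "represented_connection \<sigma> \<mu>"
proof -
  interpret finite_measure \<mu>
    using assms(2) by (simp add: associated_measure_def)
  show ?thesis
  proof
    show "connection \<sigma>" by fact
    show "sets \<mu> = sets borel_unit_interval"
      using assms(2) by (simp add: associated_measure_def)
    fix A B :: "'a \<Rightarrow>\<^sub>L 'a" and x y
    assume "strictly_positive_op A" "strictly_positive_op B"
    then have "has_bochner_integral \<mu> (\<lambda>t. cinner x (weighted_harmonic_mean t A B y)) (cinner x (\<sigma> A B y))"
      using assms(2) by (simp add: associated_measure_def strictly_positive_op_def)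
    from has_bochner_integral_bounded_linear[OF bounded_linear_Re this]
    show "has_bochner_integral \<mu> (\<lambda>t. inner x (weighted_harmonic_mean t A B y)) (inner x (\<sigma> A B y))"
      by (simp only: Re_cinner)
  qed
qed

text \<open>The nonzero vector excludes the zero space, where all operators coincide, so that every
  operation is both cancellable and a scalar multiple of the trivial means. Existence of the
  associated measure, a known fact, enters as a hypothesis, in the last conjunct through
  \<nu>.\<close>

theorem corollary2p6:
  fixes \<sigma> :: "'a::complex_hilbert_space op_binary"
    and f :: "real \<Rightarrow> real"
    and \<mu> :: "real measure"
  assumes "\<exists>x::'a. x \<noteq> 0"
    and "connection \<sigma>"
    and "representing_function \<sigma> f"
    and "associated_measure \<sigma> \<mu>"
  shows "(cancellable \<sigma> \<longleftrightarrow>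
           \<not> scalar_multiple_of \<sigma> left_trivial_mean \<and>
           \<not> scalar_multiple_of \<sigma> right_trivial_mean) \<and>
         (cancellable \<sigma> \<longleftrightarrow>
           inj_on f {0..} \<and> inj_on (transpose_fun f) {0..}) \<and>
         (cancellable \<sigma> \<longleftrightarrow>
           \<not> (\<exists>c. \<forall>x\<ge>0. f x = c) \<and>
           \<not> (\<exists>c\<ge>0. \<forall>x\<ge>0. f x = c * x)) \<and>
         (cancellable \<sigma> \<longleftrightarrow>
           \<not> scalar_multiple_of_dirac \<mu> 0 \<and>
           \<not> scalar_multiple_of_dirac \<mu> 1) \<and>
         (\<forall>(\<tau> :: 'a op_binary) \<nu>.
           nontrivial_mean \<tau> \<and> associated_measure \<tau> \<nu> \<longrightarrow> cancellable \<tau>)"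
proof (intro conjI allI impI)
  interpret represented_connection \<sigma> \<mu>
    by (rule represented_connectionI[OF assms(2,4)])
  \<comment> \<open>Cancellability becomes the statement that both masses are nonzero, the common
    form in which the conditions on f and \<mu> are matched.\<close>
  note canc = cancellable_def left_cancellable_iff(1)[OF assms(1)] right_cancellable_iff(1)[OF assms(1)]
  have f: "f x = rep_fun x" if "0 \<le> x" for x
    by (rule representing_function_eq[OF assms(1,3) that])
  show "cancellable \<sigma> \<longleftrightarrow> \<not> scalar_multiple_of \<sigma> left_trivial_mean \<and> \<not> scalar_multiple_of \<sigma> right_trivial_mean"
    using left_cancellable_iff(2)[OF assms(1)] right_cancellable_iff(2)[OF assms(1)]
    unfolding cancellable_def by blast
  have "inj_on f {0..} \<longleftrightarrow> inj_on rep_fun {0..}"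
    using f by (intro inj_on_cong) auto
  then show "cancellable \<sigma> \<longleftrightarrow> inj_on f {0..} \<and> inj_on (transpose_fun f) {0..}"
    by (simp only: canc inj_on_rep_fun_iff inj_on_transpose_fun_iff[OF f])
  show "cancellable \<sigma> \<longleftrightarrow> \<not> (\<exists>c. \<forall>x\<ge>0. f x = c) \<and> \<not> (\<exists>c\<ge>0. \<forall>x\<ge>0. f x = c * x)"
    using rep_fun_constant_iff rep_fun_linear_iff f unfolding canc by simp
  show "cancellable \<sigma> \<longleftrightarrow> \<not> scalar_multiple_of_dirac \<mu> 0 \<and> \<not> scalar_multiple_of_dirac \<mu> 1"
    using scalar_multiple_of_dirac_iff[of 0] scalar_multiple_of_dirac_iff[of 1] unfolding canc by simp
next
  fix \<tau> :: "'a op_binary" and \<nu>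
  assume \<tau>: "nontrivial_mean \<tau> \<and> associated_measure \<tau> \<nu>"
  then interpret represented_connection \<tau> \<nu>
    by (intro represented_connectionI) (auto simp: nontrivial_mean_def mean_def)
  have "\<tau> id_blinfun id_blinfun = id_blinfun"
    using \<tau> by (simp add: nontrivial_mean_def mean_def)
  from mean_scalar_multiple_of[OF assms(1) this]
  have "\<not> scalar_multiple_of \<tau> left_trivial_mean" "\<not> scalar_multiple_of \<tau> right_trivial_mean"
    using \<tau> by (auto simp: nontrivial_mean_def left_trivial_mean_def right_trivial_mean_def)
  then show "cancellable \<tau>"
    using left_cancellable_iff(2)[OF assms(1)] right_cancellable_iff(2)[OF assms(1)]
    unfolding cancellable_def by blast
qed

end
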